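(* Let $S\subset\mathbb{N}^d$ be the semigroup generated by nonzero vectors $\mathbf{m}_1,\dots,\mathbf{m}_n\in\mathbb{N}^d$, and let $V_{S_{\ell,\mathbf{m}}}\subset\mathbb{A}^{n+1}$ be an extension of $V_S\subset\mathbb{A}^n$ with $\ell\le\Delta(\mathbf{m})$. If the local ring of $V_S$ (at the origin) has non-decreasing Hilbert function, then so has the local ring of $V_{S_{\ell,\mathbf{m}}}$ (at the origin).
   Context: $K$ is an algebraically closed field of any characteristic and $\mathbb{N}$ denotes the non-negative integers. For a semigroup $S\subset\mathbb{N}^d$ generated by $\mathbf{m}_1,\dots,\mathbf{m}_n$, set $\deg_S(x_1^{b_1}\cdots x_n^{b_n})=b_1\mathbf{m}_1+\cdots+b_n\mathbf{m}_n$. The toric ideal $I_S\subset K[x_1,\dots,x_n]$ is the ideal generated by all binomials $\mathbf{x}^{\mathbf{a}}-\mathbf{x}^{\mathbf{b}}$ with $\deg_S(\mathbf{x}^{\mathbf{a}})=\deg_S(\mathbf{x}^{\mathbf{b}})$, and $V_S\subset\mathbb{A}^n$ is its zero set. For a positive integer $\ell$ and $\mathbf{m}\in\mathbb{N}^d$, $S_{\ell,\mathbf{m}}$ denotes the semigroup generated by $\ell\mathbf{m}_1,\dots,\ell\mathbf{m}_n,\mathbf{m}$ (in this order, so that $I_{S_{\ell,\mathbf{m}}}\subset K[x_1,\dots,x_{n+1}]$). $V_{S_{\ell,\mathbf{m}}}\subset\mathbb{A}^{n+1}$ is an extension of $V_S\subset\mathbb{A}^n$ if $\mathbf{m}\in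 S$ and $\ell$ is a positive integer relatively prime to a component of $\mathbf{m}$. For $\mathbf{m}\in S$, $\Delta(\mathbf{m})$ is the maximum of all sums $s_1+\cdots+s_n$ over non-negative integers $s_1,\dots,s_n$ with $\mathbf{m}=s_1\mathbf{m}_1+\cdots+s_n\mathbf{m}_n$. The local ring of $V_S$ is the localization of $K[x_1,\dots,x_n]/I_S$ at the maximal ideal $(x_1,\dots,x_n)$ of the origin. Its Hilbert function is by definition the Hilbert function of its associated graded ring (with respect to its maximal ideal), which is isomorphic to $K[x_1,\dots,x_n]/I_S^*$, where $I_S^*$ is the ideal generated by the homogeneous summands $f^*$ of smallest degree of all nonzero $f\in I_S$; i.e. $H(r)=\dim_K (K[x_1,\dots,x_n]/I_S^* )_r$ for $r\ge 0$. Non-decreasing means $H(r)\le H(r+1)$ for all $r\ge 0$. Likewise for $V_{S_{\ell,\mathbf{m}}}$. *)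

theory Defs
  imports
    "HOL-Algebra.Embedded_Algebras"
    "HOL-Algebra.Ideal_Product"
    "HOL-Algebra.QuotRing"
    "HOL-Analysis.Finite_Cartesian_Product"
    "HOL-Computational_Algebra.Polynomial"
    "HOL-Library.Poly_Mapping"
begin

section \<open>Affine semigroups\<close>

text \<open>
  A semigroup in \<open>\<nat>\<^sup>d\<close> is given by the ordered list of its generators, since the toric ideal and
  the ambient affine space depend on that list. The coordinates of \<open>\<nat>\<^sup>d\<close> are indexed by a finite
  type, the variables \<open>x\<^sub>1, \<dots>, x\<^sub>n\<close> of the polynomial ring by \<open>0, \<dots>, n - 1\<close>.
\<close>

definition lin_comb :: "(nat ^ 'd) list \<Rightarrow> (nat \<Rightarrow> nat) \<Rightarrow> nat ^ 'd" where
  "lin_comb ms s = (\<Sum>i<length ms. s i *s ms ! i)"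

definition semigroup_gen :: "(nat ^ 'd) list \<Rightarrow> (nat ^ 'd) set" where
  "semigroup_gen ms = {lin_comb ms s | s. True}"

definition Delta :: "(nat ^ 'd) list \<Rightarrow> nat ^ 'd \<Rightarrow> nat" where
  "Delta ms m = Max {(\<Sum>i<length ms. s i) | s. m = lin_comb ms s}"

definition ext_gens :: "(nat ^ 'd) list \<Rightarrow> nat \<Rightarrow> nat ^ 'd \<Rightarrow> (nat ^ 'd) list" where
  "ext_gens ms l m = map (\<lambda>v. l *s v) ms @ [m]"

definition is_extension :: "(nat ^ 'd) list \<Rightarrow> nat \<Rightarrow> nat ^ 'd \<Rightarrow> bool" where
  "is_extension ms l m \<longleftrightarrow> m \<in> semigroup_gen ms \<and> 0 < l \<and> (\<exists>i. coprime l (m $ i))"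


section \<open>Toric ideals\<close>

text \<open>A monomial is a finitely supported exponent function.\<close>

type_synonym 'k mpoly = "(nat \<Rightarrow>\<^sub>0 nat) \<Rightarrow>\<^sub>0 'k"

definition monomials :: "nat \<Rightarrow> (nat \<Rightarrow>\<^sub>0 nat) set" where
  "monomials n = {t. Poly_Mapping.keys t \<subseteq> {..<n}}"

definition poly_ring :: "nat \<Rightarrow> ('k::comm_ring_1) mpoly ring" where
  "poly_ring n = \<lparr>carrier = {p. Poly_Mapping.keys p \<subseteq> monomials n},
     monoid.mult = (*), one = 1, ring.zero = 0, add = (+)\<rparr>"

definition deg_S :: "(nat ^ 'd) list \<Rightarrow> (nat \<Rightarrow>\<^sub>0 nat) \<Rightarrow> nat ^ 'd" where
  "deg_S ms t = lin_comb ms (Poly_Mapping.lookup t)"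

definition toric_ideal :: "(nat ^ 'd) list \<Rightarrow> ('k::comm_ring_1) mpoly set" where
  "toric_ideal ms = Idl\<^bsub>poly_ring (length ms)\<^esub>
     {Poly_Mapping.single a 1 - Poly_Mapping.single b 1 | a b.
        a \<in> monomials (length ms) \<and> b \<in> monomials (length ms) \<and> deg_S ms a = deg_S ms b}"

definition origin_ideal :: "nat \<Rightarrow> ('k::comm_ring_1) mpoly set" where
  "origin_ideal n = Idl\<^bsub>poly_ring n\<^esub>
     {Poly_Mapping.single (Poly_Mapping.single i 1) 1 | i. i < n}"


section \<open>Localization\<close>

definition frac_rel :: "('a, 'b) ring_scheme \<Rightarrow> 'a set \<Rightarrow> (('a \<times> 'a) \<times> ('a \<times> 'a)) set" where
  "frac_rel R T = {((a, s), (b, t)). a \<in> carrier R \<and> b \<in> carrier R \<and> s \<in> T \<and> t \<in> T \<and>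
     (\<exists>u\<in>T. u \<otimes>\<^bsub>R\<^esub> (a \<otimes>\<^bsub>R\<^esub> t) = u \<otimes>\<^bsub>R\<^esub> (b \<otimes>\<^bsub>R\<^esub> s))}"

definition loc_frac :: "('a, 'b) ring_scheme \<Rightarrow> 'a set \<Rightarrow> 'a \<Rightarrow> 'a \<Rightarrow> ('a \<times> 'a) set" where
  "loc_frac R T a s = frac_rel R T `` {(a, s)}"

definition localization :: "('a, 'b) ring_scheme \<Rightarrow> 'a set \<Rightarrow> ('a \<times> 'a) set ring" where
  "localization R T = \<lparr>carrier = (carrier R \<times> T) // frac_rel R T,
     monoid.mult = (\<lambda>X Y. \<Union>(a, s)\<in>X. \<Union>(b, t)\<in>Y. loc_frac R T (a \<otimes>\<^bsub>R\<^esub> b) (s \<otimes>\<^bsub>R\<^esub> t)),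
     one = loc_frac R T \<one>\<^bsub>R\<^esub> \<one>\<^bsub>R\<^esub>,
     ring.zero = loc_frac R T \<zero>\<^bsub>R\<^esub> \<one>\<^bsub>R\<^esub>,
     add = (\<lambda>X Y. \<Union>(a, s)\<in>X. \<Union>(b, t)\<in>Y.
       loc_frac R T ((a \<otimes>\<^bsub>R\<^esub> t) \<oplus>\<^bsub>R\<^esub> (b \<otimes>\<^bsub>R\<^esub> s)) (s \<otimes>\<^bsub>R\<^esub> t))\<rparr>"

definition local_ring_at :: "('a, 'b) ring_scheme \<Rightarrow> 'a set \<Rightarrow> ('a \<times> 'a) set ring" where
  "local_ring_at R P = localization R (carrier R - P)"

definition local_max_ideal :: "('a, 'b) ring_scheme \<Rightarrow> 'a set \<Rightarrow> ('a \<times> 'a) set set" where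
  "local_max_ideal R P = {loc_frac R (carrier R - P) a s | a s. a \<in> P \<and> s \<in> carrier R - P}"


section \<open>Hilbert functions of local rings\<close>

text \<open>
  Let \<open>R\<close> be a local ring with maximal ideal \<open>M\<close>, containing a field \<open>k\<close>. The graded piece
  \<open>M\<^sup>r / M\<^sup>r\<^sup>+\<^sup>1\<close> of the associated graded ring is taken inside the ring \<open>R / M\<^sup>r\<^sup>+\<^sup>1\<close>, which contains
  the image of \<open>k\<close> as a subfield; this makes the library's dimension of subspaces of a ring
  available. Powers of \<open>M\<close> are powers in the semiring of ideals, so \<open>M\<^sup>0 = R\<close>.
\<close>

definition graded_piece :: "('a, 'b) ring_scheme \<Rightarrow> 'a set \<Rightarrow> nat \<Rightarrow> 'a set set" where
  "graded_piece R M r =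
     (\<lambda>a. (M [^]\<^bsub>ideals_set R\<^esub> Suc r) +>\<^bsub>R\<^esub> a) ` (M [^]\<^bsub>ideals_set R\<^esub> r)"

definition hilbert_fun :: "('a, 'b) ring_scheme \<Rightarrow> 'a set \<Rightarrow> 'a set \<Rightarrow> nat \<Rightarrow> nat" where
  "hilbert_fun R k M r =
     ring.dim (R Quot (M [^]\<^bsub>ideals_set R\<^esub> Suc r))
       ((\<lambda>c. (M [^]\<^bsub>ideals_set R\<^esub> Suc r) +>\<^bsub>R\<^esub> c) ` k) (graded_piece R M r)"


section \<open>The local ring of a toric variety at the origin\<close>

definition coord_ring :: "('k::comm_ring_1) itself \<Rightarrow> (nat ^ 'd) list \<Rightarrow> 'k mpoly set ring" where
  "coord_ring _ ms = poly_ring (length ms) Quot toric_ideal ms"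

definition coord_class :: "(nat ^ 'd) list \<Rightarrow> ('k::comm_ring_1) mpoly \<Rightarrow> 'k mpoly set" where
  "coord_class ms p = toric_ideal ms +>\<^bsub>poly_ring (length ms)\<^esub> p"

definition coord_origin_ideal :: "('k::comm_ring_1) itself \<Rightarrow> (nat ^ 'd) list \<Rightarrow> 'k mpoly set set"
  where "coord_origin_ideal _ ms = coord_class ms ` origin_ideal (length ms)"

definition toric_local_ring ::
  "('k::comm_ring_1) itself \<Rightarrow> (nat ^ 'd) list \<Rightarrow> ('k mpoly set \<times> 'k mpoly set) set ring" where
  "toric_local_ring K ms = local_ring_at (coord_ring K ms) (coord_origin_ideal K ms)"

definition toric_max_ideal ::
  "('k::comm_ring_1) itself \<Rightarrow> (nat ^ 'd) list \<Rightarrow> ('k mpoly set \<times> 'k mpoly set) set set" where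
  "toric_max_ideal K ms = local_max_ideal (coord_ring K ms) (coord_origin_ideal K ms)"

text \<open>The image of the ground field in the local ring.\<close>

definition toric_constants ::
  "('k::comm_ring_1) itself \<Rightarrow> (nat ^ 'd) list \<Rightarrow> ('k mpoly set \<times> 'k mpoly set) set set" where
  "toric_constants K ms =
     {loc_frac (coord_ring K ms) (carrier (coord_ring K ms) - coord_origin_ideal K ms)
        (coord_class ms (Poly_Mapping.single 0 c)) \<one>\<^bsub>coord_ring K ms\<^esub> | c :: 'k. True}"

definition toric_hilbert_fun :: "('k::field) itself \<Rightarrow> (nat ^ 'd) list \<Rightarrow> nat \<Rightarrow> nat" where
  "toric_hilbert_fun K ms =
     hilbert_fun (toric_local_ring K ms) (toric_constants K ms) (toric_max_ideal K ms)"

end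

theory Submission
  imports Defs "HOL-Number_Theory.Cong"
begin

text \<open>
  The Hilbert function of the local ring counts the elements of each order: \<open>H\<^sub>S(r)\<close> is the number of
  \<open>x \<in> S\<close> with \<open>\<Delta>(x) = r\<close>. Indeed, modulo the toric ideal polynomials become elements of the
  semigroup algebra \<open>K[S]\<close>, on which the powers of the maximal ideal are the filtration by \<open>\<Delta>\<close>, and
  monomials of maximal degree representing the \<open>x\<close> with \<open>\<Delta>(x) = r\<close> form a basis of the \<open>r\<close>-th graded
  piece. Coprimality of \<open>l\<close> with a component of \<open>m\<close> makes every element of the extended
  semigroup uniquely \<open>l x + k m\<close> with \<open>x \<in> S\<close> and \<open>k < l\<close>, and \<open>l \<le> \<Delta>(m)\<close> gives it order \<open>\<Delta>(x) + k\<close>.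
  Hence the extended Hilbert function is \<open>r \<mapsto> \<Sum>k<l. H\<^sub>S(r - k)\<close>, with \<open>H\<^sub>S\<close> zero at negative arguments.
\<close>

section \<open>Orders in affine semigroups\<close>

lemma lin_comb_cong: "(\<And>i. i < length ms \<Longrightarrow> s i = t i) \<Longrightarrow> lin_comb ms s = lin_comb ms t"
  by (simp add: lin_comb_def)

lemma lin_comb_add: "lin_comb ms (\<lambda>i. s i + t i) = lin_comb ms s + lin_comb ms t"
  by (simp add: lin_comb_def sum.distrib vec_eq_iff algebra_simps)

lemma lin_comb_0 [simp]: "lin_comb ms (\<lambda>_. 0) = 0"
  by (simp add: lin_comb_def vec_eq_iff)

lemma lin_comb_smult: "lin_comb ms (\<lambda>i. k * s i) = k *s lin_comb ms s"
  by (simp add: lin_comb_def vec_eq_iff sum_distrib_left mult.assoc)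

lemma lin_comb_in_semigroup [simp]: "lin_comb ms s \<in> semigroup_gen ms"
  by (auto simp: semigroup_gen_def)

lemma semigroup_zero [simp]: "0 \<in> semigroup_gen ms"
  using lin_comb_in_semigroup[of ms "\<lambda>_. 0"] by simp

lemma semigroup_add: "x \<in> semigroup_gen ms \<Longrightarrow> y \<in> semigroup_gen ms \<Longrightarrow> x + y \<in> semigroup_gen ms"
  by (auto simp: semigroup_gen_def lin_comb_add[symmetric])

lemma semigroup_smult: "x \<in> semigroup_gen ms \<Longrightarrow> k *s x \<in> semigroup_gen ms"
  by (auto simp: semigroup_gen_def lin_comb_smult[symmetric])

definition level :: "(nat ^ 'd) list \<Rightarrow> nat \<Rightarrow> (nat ^ 'd) set" where
  "level ms r = {x \<in> semigroup_gen ms. Delta ms x = r}"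

text \<open>Nonzero generators bound the length of every factorization of an element, so that the
  \<open>Max\<close> in \<open>Delta\<close> is taken over a finite set.\<close>

locale nonzero_gens =
  fixes ms :: "(nat ^ 'd) list"
  assumes nonzero: "0 \<notin> set ms"
begin

abbreviation n where "n \<equiv> length ms"
abbreviation S where "S \<equiv> semigroup_gen ms"
abbreviation ord where "ord \<equiv> Delta ms"

text \<open>A nonzero vector of natural numbers has a component at least 1, so each of the
  \<open>s i\<close> copies of a generator adds at least 1 to the sum of all components.\<close>

lemma weight_le: "(\<Sum>i<n. s i) \<le> (\<Sum>j\<in>UNIV. lin_comb ms s $ j)"
proof -
  have "s i \<le> (\<Sum>j\<in>UNIV. s i * (ms ! i) $ j)" if "i < n" for i
  proof -
    have "ms ! i \<noteq> 0" using nonzero that by (metis nth_mem)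
    then obtain j where "(ms ! i) $ j \<noteq> 0" by (auto simp: vec_eq_iff)
    then have "s i \<le> s i * (ms ! i) $ j" by simp
    also have "\<dots> \<le> (\<Sum>j\<in>UNIV. s i * (ms ! i) $ j)"
      by (rule member_le_sum) auto
    finally show ?thesis .
  qed
  then have "(\<Sum>i<n. s i) \<le> (\<Sum>i<n. \<Sum>j\<in>UNIV. s i * (ms ! i) $ j)"
    by (intro sum_mono) auto
  also have "\<dots> = (\<Sum>j\<in>UNIV. lin_comb ms s $ j)"
    by (subst sum.swap) (simp add: lin_comb_def)
  finally show ?thesis .
qed

lemma finite_weights: "finite {(\<Sum>i<n. s i) | s. x = lin_comb ms s}"
  by (rule finite_subset[of _ "{..(\<Sum>j\<in>UNIV. x $ j)}"]) (auto simp: weight_le)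

lemma weight_le_ord: "(\<Sum>i<n. s i) \<le> ord (lin_comb ms s)"
  unfolding Delta_def by (rule Max_ge[OF finite_weights]) blast

lemma ord_attained:
  assumes "x \<in> S"
  obtains s where "lin_comb ms s = x" "(\<Sum>i<n. s i) = ord x"
proof -
  have "ord x \<in> {(\<Sum>i<n. s i) | s. x = lin_comb ms s}"
    unfolding Delta_def using assms
    by (intro Max_in[OF finite_weights]) (auto simp: semigroup_gen_def)
  then show ?thesis using that by auto
qed

text \<open>Adding two longest factorizations gives a factorization of the sum, though perhaps not a
  longest one. This inequality is what makes the filtration by order on the semigroup algebra
  multiplicative.\<close>

lemma ord_superadditive:
  assumes "x \<in> S" "y \<in> S"
  shows "ord x + ord y \<le> ord (x + y)"
proof -
  obtain s t where s: "lin_comb ms s = x" "(\<Sum>i<n. s i) = ord x"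
    and t: "lin_comb ms t = y" "(\<Sum>i<n. t i) = ord y"
    using assms ord_attained by metis
  show ?thesis
    using weight_le_ord[of "\<lambda>i. s i + t i"] s t by (simp add: lin_comb_add sum.distrib)
qed

lemma ord_smult_ge:
  assumes "x \<in> S"
  shows "k * ord x \<le> ord (k *s x)"
proof -
  obtain s where s: "lin_comb ms s = x" "(\<Sum>i<n. s i) = ord x"
    using assms ord_attained by metis
  show ?thesis
    using weight_le_ord[of "\<lambda>i. k * s i"] s by (simp add: lin_comb_smult sum_distrib_left[symmetric])
qed

lemma ord_eq_0_iff:
  assumes "x \<in> S"
  shows "ord x = 0 \<longleftrightarrow> x = 0"
proof -
  obtain s where s: "lin_comb ms s = x" "(\<Sum>i<n. s i) = ord x"
    using assms ord_attained by metis
  show ?thesis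
  proof
    assume "ord x = 0"
    then have "lin_comb ms s = lin_comb ms (\<lambda>_. 0)" using s by (intro lin_comb_cong) auto
    then show "x = 0" using s by simp
  next
    assume "x = 0"
    then show "ord x = 0" using weight_le[of s] s by simp
  qed
qed

text \<open>A longest factorization of an element of order \<open>r\<close> has all its coefficients
  bounded by \<open>r\<close>, which leaves finitely many choices.\<close>

lemma finite_level: "finite (level ms r)"
proof (rule finite_surj)
  show "finite {s. \<forall>i. (i \<in> {..<n} \<longrightarrow> s i \<in> {..r}) \<and> (i \<notin> {..<n} \<longrightarrow> s i = 0)}"
    by (rule finite_set_of_finite_funs) auto
  show "level ms r \<subseteq> lin_comb ms ` {s. \<forall>i. (i \<in> {..<n} \<longrightarrow> s i \<in> {..r}) \<and> (i \<notin> {..<n} \<longrightarrow> s i = 0)}"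
  proof
    fix x assume "x \<in> level ms r"
    then obtain s where s: "lin_comb ms s = x" "(\<Sum>i<n. s i) = r"
      using ord_attained by (metis (mono_tags, lifting) level_def mem_Collect_eq)
    \<comment> \<open>\<open>lin_comb\<close> ignores the values beyond index \<open>n\<close>;
      setting them to zero puts the coefficient function into a finite set of functions.\<close>
    define t where "t i = (if i < n then s i else 0)" for i
    have "t i \<le> r" if "i < n" for i
      using that s(2) member_le_sum[of i "{..<n}" s] by (auto simp: t_def)
    moreover have "lin_comb ms t = x"
      unfolding s(1)[symmetric] by (rule lin_comb_cong) (simp add: t_def)
    ultimately show "x \<in> lin_comb ms ` {s. \<forall>i. (i \<in> {..<n} \<longrightarrow> s i \<in> {..r}) \<and> (i \<notin> {..<n} \<longrightarrow> s i = 0)}"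
      by (intro image_eqI[of _ _ t]) (auto simp: t_def)
  qed
qed

end

section \<open>Orders in the extended semigroup\<close>

lemma length_ext_gens [simp]: "length (ext_gens ms l m) = Suc (length ms)"
  by (simp add: ext_gens_def)

lemma lin_comb_ext_gens:
  "lin_comb (ext_gens ms l m) s = l *s lin_comb ms s + s (length ms) *s m"
proof -
  have "(\<Sum>i<length ms. s i *s ext_gens ms l m ! i) = l *s lin_comb ms s"
    by (simp add: ext_gens_def nth_append lin_comb_def vec_eq_iff sum_distrib_left algebra_simps)
  then show ?thesis
    by (simp add: lin_comb_def ext_gens_def nth_append)
qed

locale toric_extension = nonzero_gens ms for ms :: "(nat ^ 'd) list" +
  fixes l :: nat and m :: "nat ^ 'd"
  assumes extension: "is_extension ms l m" and l_le: "l \<le> Delta ms m"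
begin

abbreviation "ms' \<equiv> ext_gens ms l m"

lemma m_in: "m \<in> S" and l_pos: "0 < l" and coprime: "\<exists>i. coprime l (m $ i)"
  using extension by (auto simp: is_extension_def)

text \<open>The bound \<open>l \<le> Delta ms m\<close> with \<open>l\<close> positive forces
  \<open>m\<close> to have positive order. Hence the extended list of generators again consists of
  nonzero vectors and has a well-behaved order.\<close>

lemma m_nonzero: "m \<noteq> 0"
  using l_le l_pos ord_eq_0_iff[OF m_in] by auto

lemma nonzero_gens_ext: "nonzero_gens ms'"
proof
  show "0 \<notin> set ms'"
    using nonzero m_nonzero l_pos
    by (auto simp: ext_gens_def vec_eq_iff[of 0 "l *s _"]) (metis vec_eq_iff zero_index)
qed

text \<open>The component of \<open>m\<close> that is coprime to \<open>l\<close> is invertible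
  modulo \<open>l\<close>, so \<open>k\<close> is determined modulo \<open>l\<close>, and then
  exactly because it is below \<open>l\<close>. Cancelling \<open>k *s m\<close> and dividing by
  \<open>l\<close> determines \<open>x\<close>.\<close>

lemma decomposition_unique:
  assumes eq: "l *s x + k *s m = l *s x' + k' *s m" and k: "k < l" "k' < l"
  shows "k = k' \<and> x = x'"
proof -
  obtain i where i: "coprime l (m $ i)" using coprime by blast
  have "l * x $ j + k * m $ j = l * x' $ j + k' * m $ j" for j
    using arg_cong[OF eq, of "\<lambda>v. v $ j"] by simp
  then have "(k * m $ i) mod l = (k' * m $ i) mod l"
    by (metis mod_mult_self4)
  then have "k = k'"
    using i k by (metis cong_def cong_mult_rcancel_nat coprime_commute mod_less)
  with eq l_pos show ?thesis by (simp add: vec_eq_iff)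
qed

text \<open>In a factorization over the extended generators, \<open>l\<close> copies of
  \<open>m\<close> can be traded for \<open>l\<close> times a longest factorization of
  \<open>m\<close> in \<open>S\<close>. Such a trade replaces weight \<open>l\<close> by weight
  \<open>Delta ms m\<close>, hence loses nothing by \<open>l_le\<close>. So some longest
  factorization uses \<open>m\<close> exactly \<open>k\<close> times, and the rest is a longest
  factorization of \<open>x\<close>.\<close>

lemma ord_ext:
  assumes x: "x \<in> S" and k: "k < l"
  shows "Delta ms' (l *s x + k *s m) = ord x + k"
proof (rule antisym)
  interpret ext: nonzero_gens ms' by (rule nonzero_gens_ext)
  obtain s where s: "lin_comb ms s = x" "(\<Sum>i<n. s i) = ord x"
    using x ord_attained by metis
  \<comment> \<open>The slot \<open>n\<close> is ignored by \<open>lin_comb ms\<close> and holds the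
    coefficient of the last generator of \<open>ms'\<close>, so \<open>k\<close> can be stored
    there.\<close>
  define t where "t = s(n := k)"
  have [simp]: "lin_comb ms t = x" unfolding s(1)[symmetric] by (rule lin_comb_cong) (simp add: t_def)
  have [simp]: "(\<Sum>i<n. t i) = ord x" unfolding s(2)[symmetric] by (simp add: t_def)
  have [simp]: "t n = k" by (simp add: t_def)
  show "ord x + k \<le> Delta ms' (l *s x + k *s m)"
    using ext.weight_le_ord[of t] by (simp add: lin_comb_ext_gens)
  have "l *s x + k *s m \<in> ext.S"
    using lin_comb_in_semigroup[of ms' t] by (simp add: lin_comb_ext_gens)
  then obtain u where u: "lin_comb ms' u = l *s x + k *s m"
      "(\<Sum>i<Suc n. u i) = Delta ms' (l *s x + k *s m)"
    using ext.ord_attained by (metis length_ext_gens)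
  \<comment> \<open>\<open>j\<close> counts the complete blocks of \<open>l\<close> copies of
    \<open>m\<close> in the longest factorization \<open>u\<close>. Each block equals
    \<open>l *s m\<close> and can be absorbed into the part coming from \<open>S\<close>, leaving a
    remainder below \<open>l\<close>.\<close>
  define j where "j = u n div l"
  have un: "u n = j * l + u n mod l" by (simp add: j_def)
  have "l *s (lin_comb ms u + j *s m) + (u n mod l) *s m = lin_comb ms' u"
  proof -
    have "u n * y = l * (j * y) + (u n mod l) * y" for y
      by (subst un) (simp add: algebra_simps)
    then show ?thesis
      by (simp add: lin_comb_ext_gens vec_eq_iff distrib_left)
  qed
  with u k l_pos have *: "u n mod l = k" "lin_comb ms u + j *s m = x"
    using decomposition_unique[of "lin_comb ms u + j *s m" "u n mod l" x k] by auto
  \<comment> \<open>The hypothesis \<open>l_le\<close> enters here: a block of \<open>l\<close>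
    copies of \<open>m\<close> weighs no more than the order of \<open>m\<close> in
    \<open>S\<close>.\<close>
  have "(\<Sum>i<n. u i) + j * l \<le> ord (lin_comb ms u) + ord (j *s m)"
    using weight_le_ord[of u] ord_smult_ge[OF m_in, of j] mult_le_mono2[OF l_le, of j] by linarith
  also have "\<dots> \<le> ord x"
    using ord_superadditive[of "lin_comb ms u" "j *s m"] *(2) m_in semigroup_smult by auto
  finally show "Delta ms' (l *s x + k *s m) \<le> ord x + k"
    using u(2) un *(1) by simp
qed

text \<open>Since \<open>l\<close> copies of \<open>m\<close> amount to \<open>l\<close> times an
  element of \<open>S\<close>, the multiplicity of \<open>m\<close> can be reduced modulo
  \<open>l\<close>.\<close>

lemma ext_semigroup:
  "semigroup_gen ms' = {l *s x + k *s m | x k. x \<in> S \<and> k < l}"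
proof (intro equalityI subsetI)
  fix y assume "y \<in> semigroup_gen ms'"
  then obtain u where y: "y = lin_comb ms' u" by (auto simp: semigroup_gen_def)
  define j where "j = u n div l"
  have un: "u n = j * l + u n mod l" by (simp add: j_def)
  have "y = l *s (lin_comb ms u + j *s m) + (u n mod l) *s m"
    unfolding lin_comb_ext_gens y by (subst un) (simp add: vec_eq_iff algebra_simps)
  moreover have "lin_comb ms u + j *s m \<in> S"
    by (intro semigroup_add semigroup_smult m_in) auto
  ultimately show "y \<in> {l *s x + k *s m | x k. x \<in> S \<and> k < l}"
    using mod_less_divisor[OF l_pos] by blast
next
  fix y assume "y \<in> {l *s x + k *s m | x k. x \<in> S \<and> k < l}"
  then obtain s k where y: "y = l *s lin_comb ms s + k *s m" by (auto simp: semigroup_gen_def)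
  have "lin_comb ms (s(n := k)) = lin_comb ms s" by (rule lin_comb_cong) simp
  then have "y = lin_comb ms' (s(n := k))" by (simp add: y lin_comb_ext_gens)
  then show "y \<in> semigroup_gen ms'" by simp
qed

text \<open>The pairs \<open>(k, x)\<close> parametrize the extended semigroup bijectively and carry
  the order \<open>ord x + k\<close>, so a level is a disjoint union of copies of lower levels of
  \<open>S\<close>. The condition \<open>k \<le> r\<close> excludes truncated subtraction in
  \<open>r - k\<close>.\<close>

lemma card_level_ext:
  "card (level ms' r) = (\<Sum>k\<in>{k. k < l \<and> k \<le> r}. card (level ms (r - k)))"
proof -
  have "level ms' r = (\<lambda>(k, x). l *s x + k *s m) ` (SIGMA k:{k. k < l \<and> k \<le> r}. level ms (r - k))"
  proof (intro equalityI subsetI)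
    fix y assume "y \<in> level ms' r"
    then obtain x k where *: "y = l *s x + k *s m" "x \<in> S" "k < l" "Delta ms' y = r"
      by (auto simp: level_def ext_semigroup)
    then have "ord x + k = r" using ord_ext by metis
    with * show "y \<in> (\<lambda>(k, x). l *s x + k *s m) ` (SIGMA k:{k. k < l \<and> k \<le> r}. level ms (r - k))"
      by (intro image_eqI[of _ _ "(k, x)"]) (auto simp: level_def)
  qed (auto simp: level_def ext_semigroup ord_ext)
  moreover have "inj_on (\<lambda>(k, x). l *s x + k *s m) (SIGMA k:{k. k < l \<and> k \<le> r}. level ms (r - k))"
    by (auto intro!: inj_onI dest: decomposition_unique)
  ultimately show ?thesis
    by (simp add: card_image card_SigmaI finite_level)
qed

text \<open>The summands for \<open>r\<close> and \<open>Suc r\<close> are compared for equal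
  \<open>k\<close>. The index set for \<open>Suc r\<close> may contain the additional index
  \<open>k = Suc r\<close>, which can only increase the sum.\<close>

lemma card_level_ext_mono:
  assumes "\<And>r. card (level ms r) \<le> card (level ms (Suc r))"
  shows "card (level ms' r) \<le> card (level ms' (Suc r))"
proof -
  have "card (level ms' r) \<le> (\<Sum>k\<in>{k. k < l \<and> k \<le> r}. card (level ms (Suc r - k)))"
    unfolding card_level_ext by (intro sum_mono) (use assms in \<open>auto simp: Suc_diff_le\<close>)
  also have "\<dots> \<le> card (level ms' (Suc r))"
    unfolding card_level_ext by (intro sum_mono2) auto
  finally show ?thesis .
qed

end


section \<open>Localization of commutative rings\<close>

locale mult_submonoid = cring R for R :: "('a, 'b) ring_scheme" (structure) +
  fixes T :: "'a set"
  assumes T_carrier: "T \<subseteq> carrier R" and one_T: "\<one> \<in> T"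
    and mult_T: "s \<in> T \<Longrightarrow> t \<in> T \<Longrightarrow> s \<otimes> t \<in> T"
begin

abbreviation frac where "frac \<equiv> loc_frac R T"
abbreviation L where "L \<equiv> localization R T"

lemma TD: "s \<in> T \<Longrightarrow> s \<in> carrier R"
  using T_carrier by auto

text \<open>Multiplying the first relation by \<open>w \<otimes> v\<close> and the second by
  \<open>u \<otimes> s\<close> makes their middle terms agree. What remains common to both ends is
  \<open>u \<otimes> w \<otimes> t\<close>, containing the middle denominator \<open>t\<close>; it
  serves as the new witness.\<close>

lemma frac_rel_trans:
  assumes "a \<in> carrier R" "b \<in> carrier R" "c \<in> carrier R" "s \<in> T" "t \<in> T" "v \<in> T" "u \<in> T" "w \<in> T"
    and 1: "u \<otimes> (a \<otimes> t) = u \<otimes> (b \<otimes> s)" and 2: "w \<otimes> (b \<otimes> v) = w \<otimes> (c \<otimes> t)"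
  shows "(u \<otimes> w \<otimes> t) \<otimes> (a \<otimes> v) = (u \<otimes> w \<otimes> t) \<otimes> (c \<otimes> s)"
proof -
  note carr = assms(1-3) assms(4-8)[THEN TD]
  have "(u \<otimes> w \<otimes> t) \<otimes> (a \<otimes> v) = (w \<otimes> v) \<otimes> (u \<otimes> (a \<otimes> t))"
    using carr by (simp add: m_ac)
  also have "\<dots> = (u \<otimes> s) \<otimes> (w \<otimes> (b \<otimes> v))"
    unfolding 1 using carr by (simp add: m_ac)
  also have "\<dots> = (u \<otimes> w \<otimes> t) \<otimes> (c \<otimes> s)"
    unfolding 2 using carr by (simp add: m_ac)
  finally show ?thesis .
qed

lemma frac_rel_equiv: "equiv (carrier R \<times> T) (frac_rel R T)"
proof (rule equivI)
  show "frac_rel R T \<subseteq> (carrier R \<times> T) \<times> (carrier R \<times> T)"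
    by (auto simp: frac_rel_def)
  show "refl_on (carrier R \<times> T) (frac_rel R T)"
    using one_T by (auto simp: frac_rel_def refl_on_def)
  show "sym (frac_rel R T)"
  proof (rule symI)
    fix x y assume "(x, y) \<in> frac_rel R T"
    then obtain a s b t u where "x = (a, s)" "y = (b, t)" "a \<in> carrier R" "b \<in> carrier R"
      "s \<in> T" "t \<in> T" "u \<in> T" "u \<otimes> (b \<otimes> s) = u \<otimes> (a \<otimes> t)"
      by (auto simp: frac_rel_def)
    then show "(y, x) \<in> frac_rel R T"
      unfolding frac_rel_def by blast
  qed
  show "trans (frac_rel R T)"
  proof (rule transI)
    fix x y z assume "(x, y) \<in> frac_rel R T" "(y, z) \<in> frac_rel R T"
    then obtain a s b t c v u w where *: "x = (a, s)" "y = (b, t)" "z = (c, v)"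
      "a \<in> carrier R" "b \<in> carrier R" "c \<in> carrier R" "s \<in> T" "t \<in> T" "v \<in> T" "u \<in> T" "w \<in> T"
      "u \<otimes> (a \<otimes> t) = u \<otimes> (b \<otimes> s)" "w \<otimes> (b \<otimes> v) = w \<otimes> (c \<otimes> t)"
      by (auto simp: frac_rel_def)
    then have "(u \<otimes> w \<otimes> t) \<otimes> (a \<otimes> v) = (u \<otimes> w \<otimes> t) \<otimes> (c \<otimes> s)" "u \<otimes> w \<otimes> t \<in> T"
      using frac_rel_trans[of a b c s t v u w] mult_T by auto
    with * show "(x, z) \<in> frac_rel R T" by (auto simp: frac_rel_def)
  qed
qed

lemma frac_eq_iff:
  assumes "a \<in> carrier R" "b \<in> carrier R" "s \<in> T" "t \<in> T"
  shows "frac a s = frac b t \<longleftrightarrow> (\<exists>u\<in>T. u \<otimes> (a \<otimes> t) = u \<otimes> (b \<otimes> s))"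
proof -
  have "frac a s = frac b t \<longleftrightarrow> ((a, s), (b, t)) \<in> frac_rel R T"
    unfolding loc_frac_def using assms by (intro eq_equiv_class_iff[OF frac_rel_equiv]) auto
  then show ?thesis using assms by (simp add: frac_rel_def)
qed

lemma mem_frac_iff:
  assumes "a \<in> carrier R" "s \<in> T"
  shows "(b, t) \<in> frac a s \<longleftrightarrow> b \<in> carrier R \<and> t \<in> T \<and> frac b t = frac a s"
  using assms frac_eq_iff[of b a t s] by (auto simp: loc_frac_def frac_rel_def eq_commute)

lemma self_mem_frac: "a \<in> carrier R \<Longrightarrow> s \<in> T \<Longrightarrow> (a, s) \<in> frac a s"
  by (simp add: mem_frac_iff)

lemma carrier_L: "carrier L = {frac a s | a s. a \<in> carrier R \<and> s \<in> T}"
  by (auto simp: localization_def loc_frac_def quotient_def)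

lemma frac_in_L [simp]: "a \<in> carrier R \<Longrightarrow> s \<in> T \<Longrightarrow> frac a s \<in> carrier L"
  by (auto simp: carrier_L)

lemma L_cases:
  assumes "x \<in> carrier L"
  obtains a s where "x = frac a s" "a \<in> carrier R" "s \<in> T"
  using assms by (auto simp: carrier_L)

text \<open>The product of the witnesses of the two given equalities is a witness for the equality
  of the products.\<close>

lemma frac_mult_cong:
  assumes "a \<in> carrier R" "b \<in> carrier R" "s \<in> T" "t \<in> T"
    "a' \<in> carrier R" "b' \<in> carrier R" "s' \<in> T" "t' \<in> T"
    "frac a s = frac a' s'" "frac b t = frac b' t'"
  shows "frac (a \<otimes> b) (s \<otimes> t) = frac (a' \<otimes> b') (s' \<otimes> t')"
proof -
  obtain u w where u: "u \<in> T" "u \<otimes> (a \<otimes> s') = u \<otimes> (a' \<otimes> s)"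
    and w: "w \<in> T" "w \<otimes> (b \<otimes> t') = w \<otimes> (b' \<otimes> t)"
    using assms frac_eq_iff by metis
  note carr = assms(1,2,5,6) assms(3,4,7,8)[THEN TD] u(1)[THEN TD] w(1)[THEN TD]
  have "(u \<otimes> w) \<otimes> ((a \<otimes> b) \<otimes> (s' \<otimes> t')) = (u \<otimes> (a \<otimes> s')) \<otimes> (w \<otimes> (b \<otimes> t'))"
    using carr by (simp add: m_ac)
  also have "\<dots> = (u \<otimes> w) \<otimes> ((a' \<otimes> b') \<otimes> (s \<otimes> t))"
    unfolding u w using carr by (simp add: m_ac)
  finally show ?thesis
    using assms u w mult_T by (subst frac_eq_iff) auto
qed

lemma frac_add_cong:
  assumes "a \<in> carrier R" "b \<in> carrier R" "s \<in> T" "t \<in> T"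
    "a' \<in> carrier R" "b' \<in> carrier R" "s' \<in> T" "t' \<in> T"
    "frac a s = frac a' s'" "frac b t = frac b' t'"
  shows "frac (a \<otimes> t \<oplus> b \<otimes> s) (s \<otimes> t) = frac (a' \<otimes> t' \<oplus> b' \<otimes> s') (s' \<otimes> t')"
proof -
  obtain u w where u: "u \<in> T" "u \<otimes> (a \<otimes> s') = u \<otimes> (a' \<otimes> s)"
    and w: "w \<in> T" "w \<otimes> (b \<otimes> t') = w \<otimes> (b' \<otimes> t)"
    using assms frac_eq_iff by metis
  note carr = assms(1,2,5,6) assms(3,4,7,8)[THEN TD] u(1)[THEN TD] w(1)[THEN TD]
  have "(u \<otimes> w) \<otimes> ((a \<otimes> t \<oplus> b \<otimes> s) \<otimes> (s' \<otimes> t'))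
      = (u \<otimes> (a \<otimes> s')) \<otimes> (w \<otimes> (t \<otimes> t')) \<oplus> (w \<otimes> (b \<otimes> t')) \<otimes> (u \<otimes> (s \<otimes> s'))"
    using carr by algebra
  also have "\<dots> = (u \<otimes> w) \<otimes> ((a' \<otimes> t' \<oplus> b' \<otimes> s') \<otimes> (s \<otimes> t))"
    unfolding u w using carr by algebra
  finally show ?thesis
    using assms u w mult_T TD by (subst frac_eq_iff) auto
qed

text \<open>Multiplication in the localization is a union over all pairs of representatives. By
  \<open>frac_mult_cong\<close> all members of this family are the same class, and the family is
  nonempty, so the union is that class.\<close>

lemma mult_frac:
  assumes "a \<in> carrier R" "b \<in> carrier R" "s \<in> T" "t \<in> T"
  shows "frac a s \<otimes>\<^bsub>L\<^esub> frac b t = frac (a \<otimes> b) (s \<otimes> t)"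
proof -
  have "frac (fst x \<otimes> fst y) (snd x \<otimes> snd y) = frac (a \<otimes> b) (s \<otimes> t)"
    if "x \<in> frac a s" "y \<in> frac b t" for x y
  proof -
    obtain a' s' b' t' where "x = (a', s')" "y = (b', t')" by (cases x; cases y)
    then show ?thesis
      using that assms frac_mult_cong[of a' b' s' t' a b s t] by (simp add: mem_frac_iff)
  qed
  moreover have "frac a s \<noteq> {}" "frac b t \<noteq> {}"
    using assms self_mem_frac by blast+
  ultimately have "(\<Union>x\<in>frac a s. \<Union>y\<in>frac b t. frac (fst x \<otimes> fst y) (snd x \<otimes> snd y)) = frac (a \<otimes> b) (s \<otimes> t)"
    by (simp cong: SUP_cong_simp)
  then show ?thesis by (simp add: localization_def case_prod_beta)
qed

lemma add_frac:
  assumes "a \<in> carrier R" "b \<in> carrier R" "s \<in> T" "t \<in> T"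
  shows "frac a s \<oplus>\<^bsub>L\<^esub> frac b t = frac (a \<otimes> t \<oplus> b \<otimes> s) (s \<otimes> t)"
proof -
  have "frac (fst x \<otimes> snd y \<oplus> fst y \<otimes> snd x) (snd x \<otimes> snd y) = frac (a \<otimes> t \<oplus> b \<otimes> s) (s \<otimes> t)"
    if "x \<in> frac a s" "y \<in> frac b t" for x y
  proof -
    obtain a' s' b' t' where "x = (a', s')" "y = (b', t')" by (cases x; cases y)
    then show ?thesis
      using that assms frac_add_cong[of a' b' s' t' a b s t] by (simp add: mem_frac_iff)
  qed
  moreover have "frac a s \<noteq> {}" "frac b t \<noteq> {}"
    using assms self_mem_frac by blast+
  ultimately have "(\<Union>x\<in>frac a s. \<Union>y\<in>frac b t. frac (fst x \<otimes> snd y \<oplus> fst y \<otimes> snd x) (snd x \<otimes> snd y))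
      = frac (a \<otimes> t \<oplus> b \<otimes> s) (s \<otimes> t)"
    by (simp cong: SUP_cong_simp)
  then show ?thesis by (simp add: localization_def case_prod_beta)
qed

lemma one_L: "\<one>\<^bsub>L\<^esub> = frac \<one> \<one>" and zero_L: "\<zero>\<^bsub>L\<^esub> = frac \<zero> \<one>"
  by (simp_all add: localization_def)

lemma frac_eqI:
  assumes "a \<in> carrier R" "b \<in> carrier R" "s \<in> T" "t \<in> T" "a \<otimes> t = b \<otimes> s"
  shows "frac a s = frac b t"
  using assms one_T by (subst frac_eq_iff) (auto intro!: bexI[of _ \<one>])

lemma cring_L: "cring L"
proof (rule cringI)
  show "abelian_group L"
  proof (rule abelian_groupI)
    fix x y assume "x \<in> carrier L" "y \<in> carrier L"
    then obtain a s b t where [simp]: "x = frac a s" "y = frac b t"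
      "a \<in> carrier R" "s \<in> T" "b \<in> carrier R" "t \<in> T"
      by (metis L_cases)
    note [simp] = TD mult_T
    show "x \<oplus>\<^bsub>L\<^esub> y \<in> carrier L" by (simp add: add_frac)
    show "x \<oplus>\<^bsub>L\<^esub> y = y \<oplus>\<^bsub>L\<^esub> x" by (simp add: add_frac a_comm m_comm)
    fix z assume "z \<in> carrier L"
    then obtain c v where [simp]: "z = frac c v" "c \<in> carrier R" "v \<in> T" by (metis L_cases)
    have [simp]: "s \<in> carrier R" "t \<in> carrier R" "v \<in> carrier R" by simp_all
    have "(a \<otimes> t \<oplus> b \<otimes> s) \<otimes> v \<oplus> c \<otimes> (s \<otimes> t) = a \<otimes> (t \<otimes> v) \<oplus> (b \<otimes> v \<oplus> c \<otimes> t) \<otimes> s"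
      by (simp add: l_distr r_distr m_ac a_ac)
    then show "x \<oplus>\<^bsub>L\<^esub> y \<oplus>\<^bsub>L\<^esub> z = x \<oplus>\<^bsub>L\<^esub> (y \<oplus>\<^bsub>L\<^esub> z)" by (simp add: add_frac m_assoc)
  next
    show "\<zero>\<^bsub>L\<^esub> \<in> carrier L" using one_T by (simp add: zero_L)
  next
    fix x assume "x \<in> carrier L"
    then obtain a s where [simp]: "x = frac a s" "a \<in> carrier R" "s \<in> T" "s \<in> carrier R"
      by (metis L_cases TD)
    show "\<zero>\<^bsub>L\<^esub> \<oplus>\<^bsub>L\<^esub> x = x" using one_T by (simp add: zero_L add_frac)
    have "frac (\<ominus> a) s \<oplus>\<^bsub>L\<^esub> x = \<zero>\<^bsub>L\<^esub>"
      using one_T by (simp add: zero_L add_frac) (intro frac_eqI, auto simp: mult_T l_minus l_neg)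
    then show "\<exists>y\<in>carrier L. y \<oplus>\<^bsub>L\<^esub> x = \<zero>\<^bsub>L\<^esub>" by (intro bexI[of _ "frac (\<ominus> a) s"]) auto
  qed
  show "Group.comm_monoid L"
  proof (rule comm_monoidI)
    fix x y assume "x \<in> carrier L" "y \<in> carrier L"
    then obtain a s b t where [simp]: "x = frac a s" "y = frac b t"
      "a \<in> carrier R" "s \<in> T" "b \<in> carrier R" "t \<in> T"
      by (metis L_cases)
    note [simp] = TD mult_T
    show "x \<otimes>\<^bsub>L\<^esub> y \<in> carrier L" by (simp add: mult_frac)
    show "x \<otimes>\<^bsub>L\<^esub> y = y \<otimes>\<^bsub>L\<^esub> x" by (simp add: mult_frac m_comm)
    fix z assume "z \<in> carrier L"
    then obtain c v where [simp]: "z = frac c v" "c \<in> carrier R" "v \<in> T" by (metis L_cases)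
    show "x \<otimes>\<^bsub>L\<^esub> y \<otimes>\<^bsub>L\<^esub> z = x \<otimes>\<^bsub>L\<^esub> (y \<otimes>\<^bsub>L\<^esub> z)" by (simp add: mult_frac m_assoc)
  next
    show "\<one>\<^bsub>L\<^esub> \<in> carrier L" using one_T by (simp add: one_L)
  next
    fix x assume "x \<in> carrier L"
    then obtain a s where [simp]: "x = frac a s" "a \<in> carrier R" "s \<in> T" "s \<in> carrier R"
      by (metis L_cases TD)
    show "\<one>\<^bsub>L\<^esub> \<otimes>\<^bsub>L\<^esub> x = x" using one_T by (simp add: one_L mult_frac)
  qed
  fix x y z assume "x \<in> carrier L" "y \<in> carrier L" "z \<in> carrier L"
  then obtain a s b t c v where [simp]: "x = frac a s" "y = frac b t" "z = frac c v"
    "a \<in> carrier R" "s \<in> T" "b \<in> carrier R" "t \<in> T" "c \<in> carrier R" "v \<in> T"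
    by (metis L_cases)
  have [simp]: "s \<in> carrier R" "t \<in> carrier R" "v \<in> carrier R" by (simp_all add: TD)
  show "(x \<oplus>\<^bsub>L\<^esub> y) \<otimes>\<^bsub>L\<^esub> z = x \<otimes>\<^bsub>L\<^esub> z \<oplus>\<^bsub>L\<^esub> y \<otimes>\<^bsub>L\<^esub> z"
    by (simp add: add_frac mult_frac mult_T) (intro frac_eqI; simp add: mult_T l_distr r_distr m_ac)
qed

lemma frac_hom: "(\<lambda>a. frac a \<one>) \<in> ring_hom R L"
  using one_T by (intro ring_hom_memI) (simp_all add: mult_frac add_frac one_L)

end


section \<open>Push-forward of finitely supported functions\<close>

text \<open>The linear map on finitely supported functions that sends the basis element at
  \<open>t\<close> to the one at \<open>g t\<close>, adding up coefficients over the fibres of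
  \<open>g\<close>. For additive \<open>g\<close> it respects multiplication
  (\<open>push_mult\<close>).\<close>

definition push :: "('a \<Rightarrow> 'b) \<Rightarrow> ('a \<Rightarrow>\<^sub>0 'k::comm_monoid_add) \<Rightarrow> ('b \<Rightarrow>\<^sub>0 'k)" where
  "push g p = (\<Sum>t\<in>Poly_Mapping.keys p. Poly_Mapping.single (g t) (Poly_Mapping.lookup p t))"

lemma push_superset:
  assumes "finite A" "Poly_Mapping.keys p \<subseteq> A"
  shows "push g p = (\<Sum>t\<in>A. Poly_Mapping.single (g t) (Poly_Mapping.lookup p t))"
  unfolding push_def using assms by (intro sum.mono_neutral_left) (auto simp: in_keys_iff)

lemma push_0 [simp]: "push g 0 = 0"
  by (simp add: push_def)

lemma push_add: "push g (p + q) = push g p + push g q"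
proof -
  let ?A = "Poly_Mapping.keys p \<union> Poly_Mapping.keys q"
  have "push g p = (\<Sum>t\<in>?A. Poly_Mapping.single (g t) (Poly_Mapping.lookup p t))"
    "push g q = (\<Sum>t\<in>?A. Poly_Mapping.single (g t) (Poly_Mapping.lookup q t))"
    "push g (p + q) = (\<Sum>t\<in>?A. Poly_Mapping.single (g t) (Poly_Mapping.lookup (p + q) t))"
    using keys_add[of p q] by (intro push_superset; auto)+
  then show ?thesis by (simp add: lookup_add single_add sum.distrib)
qed

lemma push_single [simp]: "push g (Poly_Mapping.single t c) = Poly_Mapping.single (g t) c"
  by (cases "c = 0") (simp_all add: push_def)

lemma push_one [simp]: "push g (1 :: _ \<Rightarrow>\<^sub>0 'k::comm_semiring_1) = Poly_Mapping.single (g 0) 1"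
  unfolding single_one[symmetric] by (rule push_single)

lemma push_sum: "push g (\<Sum>i\<in>A. f i) = (\<Sum>i\<in>A. push g (f i))"
  by (induction A rule: infinite_finite_induct) (simp_all add: push_add)

lemma push_uminus: "push g (- p) = - push g (p :: _ \<Rightarrow>\<^sub>0 'k::ab_group_add)"
  using push_add[of g p "- p"] by (simp add: eq_neg_iff_add_eq_0 add.commute)

lemma push_diff: "push g (p - q) = push g p - push g (q :: _ \<Rightarrow>\<^sub>0 'k::ab_group_add)"
  using push_add[of g p "- q"] by (simp add: push_uminus)

lemma push_push: "push g (push h p) = push (\<lambda>t. g (h t)) p"
  by (simp add: push_def[of h] push_def[of "\<lambda>t. g (h t)"] push_sum)

lemma push_cong: "(\<And>t. t \<in> Poly_Mapping.keys p \<Longrightarrow> g t = h t) \<Longrightarrow> push g p = push h p"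
  by (simp add: push_def)

lemma lookup_push:
  "Poly_Mapping.lookup (push g p) x = (\<Sum>t\<in>Poly_Mapping.keys p. Poly_Mapping.lookup p t when g t = x)"
  by (simp add: push_def lookup_sum lookup_single)

lemma push_id: "push (\<lambda>t. t) p = p"
  by (rule poly_mapping_eqI) (simp add: lookup_push when_def in_keys_iff)

lemma sum_monomials: "(\<Sum>t\<in>Poly_Mapping.keys p. Poly_Mapping.single t (Poly_Mapping.lookup p t)) = p"
  using push_id[of p] by (simp add: push_def)

lemma keys_push: "Poly_Mapping.keys (push g p) \<subseteq> g ` Poly_Mapping.keys p"
proof
  fix x assume "x \<in> Poly_Mapping.keys (push g p)"
  then have "(\<Sum>t\<in>Poly_Mapping.keys p. Poly_Mapping.lookup p t when g t = x) \<noteq> 0"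
    by (simp add: in_keys_iff lookup_push)
  then obtain t where "t \<in> Poly_Mapping.keys p" "(Poly_Mapping.lookup p t when g t = x) \<noteq> 0"
    by (rule sum.not_neutral_contains_not_neutral)
  then show "x \<in> g ` Poly_Mapping.keys p" by auto
qed

text \<open>After both factors are written as sums of monomials, only the additivity of
  \<open>g\<close> on exponents is left.\<close>

lemma push_mult:
  fixes p q :: "'a::monoid_add \<Rightarrow>\<^sub>0 'k::semiring_0" and g :: "'a \<Rightarrow> 'b::monoid_add"
  assumes "\<And>s t. g (s + t) = g s + g t"
  shows "push g (p * q) = push g p * push g q"
proof -
  have "push g (p * q) = push g (push (\<lambda>t. t) p * push (\<lambda>t. t) q)"
    by (simp add: push_id)
  also have "\<dots> = push g p * push g q"
    by (simp add: push_def[of _ p] push_def[of _ q] sum_product push_sum mult_single assms)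
  finally show ?thesis .
qed

lemma keys_uminus: "Poly_Mapping.keys (- p) = Poly_Mapping.keys (p :: _ \<Rightarrow>\<^sub>0 'k::ab_group_add)"
  by (auto simp: in_keys_iff)

lemma lookup_const_mult:
  fixes p :: "'a::monoid_add \<Rightarrow>\<^sub>0 'k::semiring_0"
  shows "Poly_Mapping.lookup (Poly_Mapping.single 0 c * p) t = c * Poly_Mapping.lookup p t"
  unfolding mult_map_scale_conv_mult[symmetric] by (simp add: map.rep_eq when_def)


section \<open>Polynomials and the semigroup algebra\<close>

lemma monomials_add: "s \<in> monomials n \<Longrightarrow> t \<in> monomials n \<Longrightarrow> s + t \<in> monomials n"
  using keys_add[of s t] by (auto simp: monomials_def)

lemma monomials_zero [simp]: "0 \<in> monomials n"
  by (simp add: monomials_def)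

lemma poly_ring_simps [simp]:
  "monoid.mult (poly_ring n) = (*)" "monoid.one (poly_ring n) = 1" "ring.zero (poly_ring n) = 0" "ring.add (poly_ring n) = (+)"
  by (simp_all add: poly_ring_def)

lemma poly_ring_carrier: "p \<in> carrier (poly_ring n) \<longleftrightarrow> Poly_Mapping.keys p \<subseteq> monomials n"
  by (simp add: poly_ring_def)

lemma poly_ring_closed:
  shows "p \<in> carrier (poly_ring n) \<Longrightarrow> q \<in> carrier (poly_ring n) \<Longrightarrow> p + q \<in> carrier (poly_ring n)"
    and "p \<in> carrier (poly_ring n) \<Longrightarrow> q \<in> carrier (poly_ring n) \<Longrightarrow> p * q \<in> carrier (poly_ring n)"
    and "p \<in> carrier (poly_ring n) \<Longrightarrow> - p \<in> carrier (poly_ring n)"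
    and "p \<in> carrier (poly_ring n) \<Longrightarrow> q \<in> carrier (poly_ring n) \<Longrightarrow> p - q \<in> carrier (poly_ring n)"
    and "0 \<in> carrier (poly_ring n)" and "1 \<in> carrier (poly_ring n)"
    and "t \<in> monomials n \<Longrightarrow> Poly_Mapping.single t c \<in> carrier (poly_ring n)"
proof -
  show add: "p + q \<in> carrier (poly_ring n)" if "p \<in> carrier (poly_ring n)" "q \<in> carrier (poly_ring n)" for p q
    using that keys_add[of p q] by (auto simp: poly_ring_carrier)
  show "p * q \<in> carrier (poly_ring n)" if "p \<in> carrier (poly_ring n)" "q \<in> carrier (poly_ring n)"
    using that keys_mult[of p q] monomials_add by (fastforce simp: poly_ring_carrier)
  show neg: "- p \<in> carrier (poly_ring n)" if "p \<in> carrier (poly_ring n)" for p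
    using that by (simp add: poly_ring_carrier keys_uminus)
  show "p - q \<in> carrier (poly_ring n)" if "p \<in> carrier (poly_ring n)" "q \<in> carrier (poly_ring n)"
    using add[OF that(1) neg[OF that(2)]] by simp
  show "t \<in> monomials n \<Longrightarrow> Poly_Mapping.single t c \<in> carrier (poly_ring n)"
    by (auto simp: poly_ring_carrier)
qed (simp_all add: poly_ring_carrier)

lemma cring_poly_ring: "cring (poly_ring n :: 'k::comm_ring_1 mpoly ring)"
proof (rule cringI)
  show "abelian_group (poly_ring n :: 'k mpoly ring)"
  proof (rule abelian_groupI)
    fix p :: "'k mpoly" assume "p \<in> carrier (poly_ring n)"
    then show "\<exists>q\<in>carrier (poly_ring n). q \<oplus>\<^bsub>poly_ring n\<^esub> p = \<zero>\<^bsub>poly_ring n\<^esub>"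
      by (intro bexI[of _ "- p"]) (auto simp: poly_ring_closed)
  qed (auto simp: poly_ring_closed algebra_simps)
  show "Group.comm_monoid (poly_ring n :: 'k mpoly ring)"
    by (rule comm_monoidI) (auto simp: poly_ring_closed algebra_simps)
qed (auto simp: algebra_simps)

lemma poly_ring_sum_closed:
  "(\<And>i. i \<in> A \<Longrightarrow> f i \<in> carrier (poly_ring n)) \<Longrightarrow> (\<Sum>i\<in>A. f i) \<in> carrier (poly_ring n)"
  by (induction A rule: infinite_finite_induct) (auto simp: poly_ring_closed)

lemma ideal_poly_ring_sum_closed:
  assumes "ideal I (poly_ring n)" "\<And>i. i \<in> A \<Longrightarrow> f i \<in> I"
  shows "(\<Sum>i\<in>A. f i) \<in> I"
proof -
  interpret I: additive_subgroup I "poly_ring n" using assms(1) by (rule ideal.axioms)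
  have "0 \<in> I" "\<And>x y. x \<in> I \<Longrightarrow> y \<in> I \<Longrightarrow> x + y \<in> I"
    using I.zero_closed I.a_closed by simp_all
  then show ?thesis using assms(2)
    by (induction A rule: infinite_finite_induct) auto
qed

lemma a_inv_poly_ring:
  fixes p :: "'k::comm_ring_1 mpoly"
  assumes "p \<in> carrier (poly_ring n)" shows "\<ominus>\<^bsub>poly_ring n\<^esub> p = - p"
proof -
  interpret cring "poly_ring n :: 'k mpoly ring" by (rule cring_poly_ring)
  show ?thesis using assms minus_equality[of "- p" p] by (simp add: poly_ring_closed)
qed

lemma ideal_poly_ringI:
  fixes I :: "'k::comm_ring_1 mpoly set"
  assumes "I \<subseteq> carrier (poly_ring n)" "0 \<in> I" "\<And>p q. p \<in> I \<Longrightarrow> q \<in> I \<Longrightarrow> p + q \<in> I"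
    "\<And>p q. p \<in> carrier (poly_ring n) \<Longrightarrow> q \<in> I \<Longrightarrow> p * q \<in> I"
  shows "ideal I (poly_ring n)"
proof -
  interpret cring "poly_ring n :: 'k mpoly ring" by (rule cring_poly_ring)
  have "- p \<in> I" if "p \<in> I" for p
    using assms(4)[of "- 1" p] that by (simp add: poly_ring_closed)
  moreover have "q * p \<in> I" if "p \<in> carrier (poly_ring n)" "q \<in> I" for p q
    using assms(4)[OF that] by (simp add: mult.commute)
  moreover have "subgroup I (add_monoid (poly_ring n))"
    using assms(1-3) calculation(1)
    by (intro add.subgroupI) (auto simp: subset_eq a_inv_poly_ring simp flip: a_inv_def)
  ultimately show ?thesis
    using assms(4) by (intro idealI[OF ring_axioms]) auto
qed

lemma deg_S_add: "deg_S ms (s + t) = deg_S ms s + deg_S ms t"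
  by (simp add: deg_S_def lookup_add[abs_def] lin_comb_add)

lemma deg_S_0 [simp]: "deg_S ms 0 = 0"
  by (simp add: deg_S_def lookup_zero[abs_def])

lemma deg_S_in [simp]: "deg_S ms t \<in> semigroup_gen ms"
  by (simp add: deg_S_def)

text \<open>On polynomials in \<open>length ms\<close> variables this is the canonical map onto the
  semigroup algebra of \<open>S\<close>; its kernel is the toric ideal, see
  \<open>toric_ideal_eq\<close>.\<close>

abbreviation phi :: "(nat ^ 'd) list \<Rightarrow> 'k::comm_ring_1 mpoly \<Rightarrow> (nat ^ 'd) \<Rightarrow>\<^sub>0 'k" where
  "phi ms \<equiv> push (deg_S ms)"

lemma phi_mult: "phi ms (p * q) = phi ms p * phi ms q"
  by (rule push_mult) (rule deg_S_add)

section \<open>The filtration of the semigroup algebra by order\<close>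

context nonzero_gens
begin

text \<open>The elements of \<open>K[S]\<close> of order at least \<open>r\<close>.\<close>

definition F :: "nat \<Rightarrow> ((nat ^ 'd) \<Rightarrow>\<^sub>0 'k::comm_ring_1) set" where
  "F r = {f. Poly_Mapping.keys f \<subseteq> {x \<in> S. r \<le> ord x}}"

lemma F_0 [simp]: "0 \<in> F r" by (simp add: F_def)

lemma F_add: "f \<in> F r \<Longrightarrow> g \<in> F r \<Longrightarrow> f + g \<in> F r"
  using keys_add[of f g] by (auto simp: F_def)

lemma F_uminus: "f \<in> F r \<Longrightarrow> - f \<in> F r"
  by (simp add: F_def keys_uminus)

lemma F_diff: "f \<in> F r \<Longrightarrow> g \<in> F r \<Longrightarrow> f - g \<in> F r"
  using F_add[of f r "- g"] F_uminus by auto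

lemma F_mult:
  assumes "f \<in> F r" "g \<in> F s"
  shows "f * g \<in> F (r + s)"
proof -
  have "x + y \<in> S \<and> r + s \<le> ord (x + y)" if "x \<in> Poly_Mapping.keys f" "y \<in> Poly_Mapping.keys g" for x y
  proof -
    have "x \<in> S" "y \<in> S" "r \<le> ord x" "s \<le> ord y" using that assms by (auto simp: F_def)
    then show ?thesis using ord_superadditive[of x y] semigroup_add[of x ms y] by auto
  qed
  then show ?thesis unfolding F_def using keys_mult[of f g] by blast
qed

lemma F_mono: "f \<in> F r \<Longrightarrow> s \<le> r \<Longrightarrow> f \<in> F s"
  by (auto simp: F_def)

lemma F_sum: "(\<And>i. i \<in> A \<Longrightarrow> f i \<in> F r) \<Longrightarrow> (\<Sum>i\<in>A. f i) \<in> F r"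
  by (induction A rule: infinite_finite_induct) (auto simp: F_add)

lemma F_single: "x \<in> S \<Longrightarrow> r \<le> ord x \<Longrightarrow> Poly_Mapping.single x c \<in> F r"
  by (auto simp: F_def)

lemma phi_F0: "phi ms p \<in> F 0"
  using keys_push[of "deg_S ms" p] by (auto simp: F_def)

text \<open>Zero is the only element of \<open>S\<close> of order zero, so \<open>F 1\<close> is the
  augmentation ideal of the semigroup algebra.\<close>

lemma F_1_iff:
  assumes "f \<in> F 0"
  shows "f \<in> F 1 \<longleftrightarrow> Poly_Mapping.lookup f 0 = 0"
proof -
  have "1 \<le> ord x \<longleftrightarrow> x \<noteq> 0" if "x \<in> S" for x
    using ord_eq_0_iff[OF that] by (cases "ord x") auto
  then show ?thesis
    using assms by (auto simp: F_def in_keys_iff subset_eq)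
qed

text \<open>Without its constant term, \<open>f\<close> lies in \<open>F 1\<close> and raises orders
  by at least one. Hence \<open>f\<close> acts on \<open>F r\<close> modulo \<open>F (Suc r)\<close>
  as multiplication by a scalar; this is how denominators are removed later.\<close>

lemma F_mult_constant:
  assumes "f \<in> F 0" "g \<in> F r"
  shows "f * g - Poly_Mapping.single 0 (Poly_Mapping.lookup f 0) * g \<in> F (Suc r)"
proof -
  have *: "f - Poly_Mapping.single 0 (Poly_Mapping.lookup f 0) \<in> F 0"
    by (intro F_diff assms F_single) auto
  have "f - Poly_Mapping.single 0 (Poly_Mapping.lookup f 0) \<in> F 1"
    unfolding F_1_iff[OF *] by (simp add: lookup_minus)
  from F_mult[OF this assms(2)] show ?thesis by (simp add: left_diff_distrib)
qed

lemma lookup_mult_0: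
  assumes "f \<in> F 0" "g \<in> F 0"
  shows "Poly_Mapping.lookup (f * g) 0 = Poly_Mapping.lookup f 0 * Poly_Mapping.lookup g 0"
proof -
  have "f * g - Poly_Mapping.single 0 (Poly_Mapping.lookup f 0) * g \<in> F 1"
    using F_mult_constant[OF assms] by simp
  then have "Poly_Mapping.lookup (f * g - Poly_Mapping.single 0 (Poly_Mapping.lookup f 0) * g) 0 = 0"
    using F_1_iff F_mono by blast
  then show ?thesis by (simp add: lookup_minus lookup_const_mult)
qed

section \<open>Total degrees and monomials of maximal degree\<close>

abbreviation weight :: "(nat \<Rightarrow>\<^sub>0 nat) \<Rightarrow> nat" where
  "weight t \<equiv> (\<Sum>i<n. Poly_Mapping.lookup t i)"

lemma weight_le_ord_deg: "weight t \<le> ord (deg_S ms t)"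
  by (simp add: deg_S_def weight_le_ord)

lemma weight_eq_0_imp:
  assumes "t \<in> monomials n" "weight t = 0"
  shows "t = 0"
  using assms by (intro poly_mapping_eqI) (auto simp: monomials_def in_keys_iff)

lemma deg_S_eq_0_iff:
  assumes "t \<in> monomials n"
  shows "deg_S ms t = 0 \<longleftrightarrow> t = 0"
proof
  assume "deg_S ms t = 0"
  then have "weight t = 0" using weight_le_ord_deg[of t] ord_eq_0_iff[of 0] by simp
  then show "t = 0" using assms weight_eq_0_imp by blast
qed simp

text \<open>A monomial of \<open>S\<close>-degree zero is constant because the generators are
  nonzero, so nothing else is merged into the constant term.\<close>

lemma lookup_phi_0:
  assumes "p \<in> carrier (poly_ring n)"
  shows "Poly_Mapping.lookup (phi ms p) 0 = Poly_Mapping.lookup p 0"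
proof -
  have "Poly_Mapping.lookup (phi ms p) 0 = (\<Sum>t\<in>Poly_Mapping.keys p. Poly_Mapping.lookup p t when t = 0)"
    unfolding lookup_push using assms deg_S_eq_0_iff
    by (intro sum.cong refl when_cong) (auto simp: poly_ring_carrier)
  also have "\<dots> = Poly_Mapping.lookup p 0" by (simp add: when_def in_keys_iff)
  finally show ?thesis .
qed

lemma monomial_split:
  assumes "t \<in> monomials n" "0 < weight t"
  obtains u i where "u \<in> monomials n" "i < n" "t = u + Poly_Mapping.single i 1" "weight t = weight u + 1"
proof -
  obtain i where i: "i < n" "0 < Poly_Mapping.lookup t i"
    using assms(2) by (metis gr0I lessThan_iff less_numeral_extra(3) sum.neutral)
  define u where "u = t - Poly_Mapping.single i 1"
  have t: "t = u + Poly_Mapping.single i 1"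
    by (rule poly_mapping_eqI) (use i in \<open>auto simp: u_def lookup_add lookup_minus lookup_single when_def\<close>)
  have "Poly_Mapping.keys u \<subseteq> Poly_Mapping.keys t"
    by (auto simp: u_def in_keys_iff lookup_minus)
  moreover have "weight t = weight u + 1"
    unfolding t using i(1) by (simp add: lookup_add lookup_single sum.distrib when_def)
  ultimately show ?thesis using that[of u i] t i assms by (auto simp: monomials_def)
qed

text \<open>A section of \<open>deg_S\<close> over \<open>S\<close> that picks monomials of the
  largest possible total degree. The total degree then equals the order, so a representative of an
  element of high order can be split into as many variables.\<close>

definition rep :: "nat ^ 'd \<Rightarrow> (nat \<Rightarrow>\<^sub>0 nat)" where
  "rep x = (SOME t. t \<in> monomials n \<and> deg_S ms t = x \<and> weight t = ord x)"

lemma rep: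
  assumes "x \<in> S"
  shows "rep x \<in> monomials n" "deg_S ms (rep x) = x" "weight (rep x) = ord x"
proof -
  obtain s where s: "lin_comb ms s = x" "(\<Sum>i<n. s i) = ord x"
    using assms ord_attained by metis
  \<comment> \<open>Truncation at \<open>n\<close> gives the exponent function finite support and
    keeps it within the first \<open>n\<close> variables.\<close>
  define t where "t = Abs_poly_mapping (\<lambda>i. if i < n then s i else 0)"
  have fin: "finite {i. (if i < n then s i else 0) \<noteq> 0}"
    by (rule finite_subset[of _ "{..<n}"]) (auto split: if_splits)
  have t: "Poly_Mapping.lookup t i = (if i < n then s i else 0)" for i
    unfolding t_def by (simp add: lookup_Abs_poly_mapping[OF fin])
  have "t \<in> monomials n" by (auto simp: monomials_def in_keys_iff t split: if_splits)
  moreover have "deg_S ms t = x"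
    unfolding deg_S_def s(1)[symmetric] by (rule lin_comb_cong) (simp add: t)
  moreover have "weight t = ord x" using s(2) by (simp add: t)
  ultimately have "\<exists>t. t \<in> monomials n \<and> deg_S ms t = x \<and> weight t = ord x" by blast
  then have "rep x \<in> monomials n \<and> deg_S ms (rep x) = x \<and> weight (rep x) = ord x"
    unfolding rep_def by (rule someI_ex)
  then show "rep x \<in> monomials n" "deg_S ms (rep x) = x" "weight (rep x) = ord x" by auto
qed

section \<open>The toric ideal and the ideal of the origin, seen in the semigroup algebra\<close>

lemma ideal_toric_ideal: "ideal (toric_ideal ms :: 'k::comm_ring_1 mpoly set) (poly_ring n)"
proof -
  interpret cring "poly_ring n :: 'k mpoly ring" by (rule cring_poly_ring)
  show ?thesis unfolding toric_ideal_def
    by (rule genideal_ideal) (auto simp: poly_ring_closed)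
qed

text \<open>Each monomial differs from the representative of its \<open>S\<close>-degree by a
  defining binomial. So modulo the toric ideal \<open>p\<close> has a normal form that depends only
  on its image in the semigroup algebra.\<close>

lemma diff_rep_in_toric_ideal:
  fixes p :: "'k::comm_ring_1 mpoly"
  assumes "p \<in> carrier (poly_ring n)"
  shows "p - push rep (phi ms p) \<in> toric_ideal ms"
proof -
  interpret cring "poly_ring n :: 'k mpoly ring" by (rule cring_poly_ring)
  interpret I: ideal "toric_ideal ms :: 'k mpoly set" "poly_ring n" by (rule ideal_toric_ideal)
  have "push rep (phi ms p) = (\<Sum>t\<in>Poly_Mapping.keys p. Poly_Mapping.single (rep (deg_S ms t)) (Poly_Mapping.lookup p t))"
    unfolding push_push by (simp add: push_def)
  then have eq: "p - push rep (phi ms p) = (\<Sum>t\<in>Poly_Mapping.keys p. Poly_Mapping.single 0 (Poly_Mapping.lookup p t) *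
      (Poly_Mapping.single t 1 - Poly_Mapping.single (rep (deg_S ms t)) 1))"
    using sum_monomials[of p] by (simp add: sum_subtractf right_diff_distrib mult_single)
  have "Poly_Mapping.single 0 (Poly_Mapping.lookup p t) *
      (Poly_Mapping.single t 1 - Poly_Mapping.single (rep (deg_S ms t)) 1) \<in> toric_ideal ms"
    if "t \<in> Poly_Mapping.keys p" for t
  proof -
    have "t \<in> monomials n" using assms that by (auto simp: poly_ring_carrier)
    then have "Poly_Mapping.single t 1 - Poly_Mapping.single (rep (deg_S ms t)) 1 \<in> (toric_ideal ms :: 'k mpoly set)"
      unfolding toric_ideal_def using rep[of "deg_S ms t"]
      by (intro genideal_self[THEN subsetD], force simp: poly_ring_closed) (intro CollectI exI[of _ t] exI[of _ "rep (deg_S ms t)"], simp)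
    from I.I_l_closed[OF this] show ?thesis by (simp add: poly_ring_closed)
  qed
  then show ?thesis
    unfolding eq by (rule ideal_poly_ring_sum_closed[OF ideal_toric_ideal])
qed

text \<open>The defining binomials vanish in the semigroup algebra. Conversely, if \<open>p\<close>
  maps to zero then its normal form is zero, and \<open>diff_rep_in_toric_ideal\<close> places
  \<open>p\<close> itself in the ideal.\<close>

lemma toric_ideal_eq:
  "toric_ideal ms = {p :: 'k::comm_ring_1 mpoly. p \<in> carrier (poly_ring n) \<and> phi ms p = 0}" (is "_ = ?Z")
proof (rule antisym)
  interpret cring "poly_ring n :: 'k mpoly ring" by (rule cring_poly_ring)
  show "toric_ideal ms \<subseteq> ?Z"
    unfolding toric_ideal_def
    by (intro genideal_minimal ideal_poly_ringI)
      (auto simp: poly_ring_closed push_add phi_mult push_diff)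
  show "?Z \<subseteq> toric_ideal ms"
    using diff_rep_in_toric_ideal by fastforce
qed

text \<open>Both sides consist of the polynomials without constant term: variables have order at
  least 1, and every nonconstant monomial is divisible by a variable.\<close>

lemma origin_ideal_eq:
  "origin_ideal n = {p :: 'k::comm_ring_1 mpoly. p \<in> carrier (poly_ring n) \<and> phi ms p \<in> F 1}" (is "_ = ?Z")
proof (rule antisym)
  interpret cring "poly_ring n :: 'k mpoly ring" by (rule cring_poly_ring)
  let ?G = "{Poly_Mapping.single (Poly_Mapping.single i 1) 1 | i. i < n} :: 'k mpoly set"
  have G: "?G \<subseteq> carrier (poly_ring n)"
    by (auto simp: monomials_def intro!: poly_ring_closed)
  have "phi ms p * f \<in> F 1" if "f \<in> F 1" for p and f :: "(nat ^ 'd) \<Rightarrow>\<^sub>0 'k"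
    using F_mult[OF phi_F0 that] by simp
  then have "ideal ?Z (poly_ring n)"
    by (intro ideal_poly_ringI) (auto simp: poly_ring_closed push_add phi_mult F_add)
  moreover have "phi ms p \<in> F 1" if "p \<in> ?G" for p
  proof -
    obtain i where i: "i < n" "p = Poly_Mapping.single (Poly_Mapping.single i 1) 1" using \<open>p \<in> ?G\<close> by auto
    then have "weight (Poly_Mapping.single i 1) = 1" by (simp add: lookup_single when_def)
    then show ?thesis
      using i weight_le_ord_deg[of "Poly_Mapping.single i 1"] by (auto intro!: F_single)
  qed
  ultimately show "origin_ideal n \<subseteq> ?Z"
    unfolding origin_ideal_def using G by (intro genideal_minimal) auto
  have I: "ideal (origin_ideal n :: 'k mpoly set) (poly_ring n)"
    unfolding origin_ideal_def by (rule genideal_ideal[OF G])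
  interpret I: ideal "origin_ideal n :: 'k mpoly set" "poly_ring n" by (rule I)
  show "?Z \<subseteq> origin_ideal n"
  proof
    fix p assume "p \<in> ?Z"
    then have p: "p \<in> carrier (poly_ring n)" "Poly_Mapping.lookup p 0 = 0"
      using F_1_iff[OF phi_F0, of p] lookup_phi_0[of p] by simp_all
    have "Poly_Mapping.single t (Poly_Mapping.lookup p t) \<in> origin_ideal n" if t: "t \<in> Poly_Mapping.keys p" for t
    proof -
      have *: "t \<in> monomials n" "t \<noteq> 0" using t p by (auto simp: poly_ring_carrier in_keys_iff)
      then have "0 < weight t"
        using weight_eq_0_imp by blast
      then obtain u i where u: "u \<in> monomials n" "i < n" "t = u + Poly_Mapping.single i 1"
        using monomial_split * by metis
      have "Poly_Mapping.single (Poly_Mapping.single i 1) 1 \<in> (origin_ideal n :: 'k mpoly set)"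
        unfolding origin_ideal_def using u by (intro genideal_self[OF G, THEN subsetD]) auto
      from I.I_l_closed[OF this poly_ring_closed(7)[OF u(1), of "Poly_Mapping.lookup p t"]]
      show ?thesis by (simp add: mult_single u)
    qed
    then have "(\<Sum>t\<in>Poly_Mapping.keys p. Poly_Mapping.single t (Poly_Mapping.lookup p t)) \<in> origin_ideal n"
      by (rule ideal_poly_ring_sum_closed[OF I])
    then show "p \<in> origin_ideal n" by (simp add: sum_monomials)
  qed
qed

end


section \<open>The local ring at the origin\<close>

lemma FactRing_zero: "\<zero>\<^bsub>R Quot I\<^esub> = I"
  by (simp add: FactRing_def)

locale toric = nonzero_gens ms for ms :: "(nat ^ 'd) list" +
  fixes K :: "'k::field itself"
begin

abbreviation P where "P \<equiv> poly_ring n :: 'k mpoly ring"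
abbreviation R where "R \<equiv> coord_ring K ms"
abbreviation L where "L \<equiv> toric_local_ring K ms"
abbreviation T where "T \<equiv> carrier R - coord_origin_ideal K ms"
abbreviation cls :: "'k mpoly \<Rightarrow> 'k mpoly set" where "cls \<equiv> coord_class ms"
abbreviation \<phi> :: "'k mpoly \<Rightarrow> (nat ^ 'd) \<Rightarrow>\<^sub>0 'k" where "\<phi> \<equiv> phi ms"
text \<open>For polynomials in \<open>P\<close> this is the value at the origin, by
  \<open>lookup_phi_0\<close>, read off in the semigroup algebra.\<close>

abbreviation \<epsilon> :: "'k mpoly \<Rightarrow> 'k" where "\<epsilon> p \<equiv> Poly_Mapping.lookup (\<phi> p) 0"

sublocale P: cring P by (rule cring_poly_ring)
sublocale R: cring R
  unfolding coord_ring_def by (rule ideal.quotient_is_cring[OF ideal_toric_ideal cring_poly_ring])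

lemma cls_hom: "cls \<in> ring_hom P R"
  unfolding coord_ring_def coord_class_def[abs_def] by (rule ideal.rcos_ring_hom[OF ideal_toric_ideal])

lemma carrier_R: "carrier R = cls ` carrier P"
  unfolding coord_ring_def coord_class_def[abs_def] FactRing_def A_RCOSETS_def' by auto

lemma cls_simps:
  "p \<in> carrier P \<Longrightarrow> cls p \<in> carrier R"
  "p \<in> carrier P \<Longrightarrow> q \<in> carrier P \<Longrightarrow> cls p \<otimes>\<^bsub>R\<^esub> cls q = cls (p * q)"
  "\<one>\<^bsub>R\<^esub> = cls 1"
  using ring_hom_closed[OF cls_hom, of p] ring_hom_mult[OF cls_hom, of p q] ring_hom_one[OF cls_hom]
  by simp_all

lemma cls_eq_iff:
  assumes "p \<in> carrier P" "q \<in> carrier P"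
  shows "cls p = cls q \<longleftrightarrow> \<phi> p = \<phi> q"
proof -
  have "p \<ominus>\<^bsub>P\<^esub> q = p - q"
    using assms by (simp add: a_minus_def a_inv_poly_ring)
  moreover have "p - q \<in> toric_ideal ms \<longleftrightarrow> \<phi> p = \<phi> q"
    using assms by (simp add: toric_ideal_eq push_diff poly_ring_closed)
  ultimately show ?thesis
    using P.quotient_eq_iff_same_a_r_cos[OF ideal_toric_ideal assms]
    unfolding coord_class_def by simp
qed

lemma mem_origin_iff:
  assumes "p \<in> carrier P"
  shows "cls p \<in> coord_origin_ideal K ms \<longleftrightarrow> \<epsilon> p = 0"
proof -
  have "cls p \<in> coord_origin_ideal K ms \<longleftrightarrow> (\<exists>q\<in>origin_ideal n. \<phi> p = \<phi> q)"
    using cls_eq_iff[OF assms] unfolding coord_origin_ideal_def origin_ideal_eq by auto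
  also have "\<dots> \<longleftrightarrow> \<phi> p \<in> F 1"
    unfolding origin_ideal_eq using assms by (metis (mono_tags, lifting) mem_Collect_eq)
  also have "\<dots> \<longleftrightarrow> \<epsilon> p = 0" by (rule F_1_iff[OF phi_F0])
  finally show ?thesis .
qed

lemma coord_origin_ideal_eq: "coord_origin_ideal K ms = {cls p | p. p \<in> carrier P \<and> \<epsilon> p = 0}"
  using mem_origin_iff unfolding coord_origin_ideal_def origin_ideal_eq by blast

lemma T_eq: "T = {cls p | p. p \<in> carrier P \<and> \<epsilon> p \<noteq> 0}"
  using mem_origin_iff unfolding carrier_R by blast

lemma cls_in_T: "p \<in> carrier P \<Longrightarrow> \<epsilon> p \<noteq> 0 \<Longrightarrow> cls p \<in> T"
  using T_eq by blast

lemma T_cases: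
  assumes "s \<in> T"
  obtains p where "s = cls p" "p \<in> carrier P" "\<epsilon> p \<noteq> 0"
  using assms T_eq by blast

lemma \<epsilon>_mult: "\<epsilon> (p * q) = \<epsilon> p * \<epsilon> q"
  by (simp add: phi_mult lookup_mult_0[OF phi_F0 phi_F0])

lemma \<epsilon>_nonzero: "\<epsilon> p \<noteq> 0 \<Longrightarrow> \<epsilon> q \<noteq> 0 \<Longrightarrow> \<epsilon> (p * q) \<noteq> 0"
  unfolding \<epsilon>_mult by simp

lemma \<epsilon>_one [simp]: "\<epsilon> 1 = 1"
  by simp

abbreviation frac where "frac \<equiv> loc_frac R T"

text \<open>The denominators are the classes with nonzero value at the origin. They are closed under
  products because \<open>\<epsilon>\<close> is multiplicative with values in a field.\<close>

sublocale Loc: mult_submonoid R T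
  rewrites "localization R T = L"
proof -
  have "\<one>\<^bsub>R\<^esub> \<in> T"
    using cls_in_T[of 1] \<epsilon>_one by (simp add: cls_simps(3) poly_ring_closed(6))
  moreover have "s \<otimes>\<^bsub>R\<^esub> t \<in> T" if "s \<in> T" "t \<in> T" for s t
  proof -
    obtain p q where "s = cls p" "p \<in> carrier P" "\<epsilon> p \<noteq> 0" "t = cls q" "q \<in> carrier P" "\<epsilon> q \<noteq> 0"
      using \<open>s \<in> T\<close> \<open>t \<in> T\<close> by (elim T_cases)
    then show ?thesis
      using cls_in_T[of "p * q"] by (simp add: cls_simps(2) \<epsilon>_mult poly_ring_closed(2))
  qed
  ultimately show "mult_submonoid R T"
    by unfold_locales auto
qed (simp add: toric_local_ring_def local_ring_at_def)

sublocale L: cring L by (rule Loc.cring_L)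

definition h :: "'k mpoly \<Rightarrow> ('k mpoly set \<times> 'k mpoly set) set" where
  "h p = frac (cls p) \<one>\<^bsub>R\<^esub>"

sublocale h: ring_hom_cring P L h
proof (intro ring_hom_cring.intro ring_hom_cring_axioms.intro P.is_cring L.is_cring)
  show "h \<in> ring_hom P L"
    using ring_hom_trans[OF cls_hom Loc.frac_hom] by (simp add: h_def[abs_def] comp_def)
qed

lemma h_simps:
  "p \<in> carrier P \<Longrightarrow> q \<in> carrier P \<Longrightarrow> h (p * q) = h p \<otimes>\<^bsub>L\<^esub> h q"
  "p \<in> carrier P \<Longrightarrow> q \<in> carrier P \<Longrightarrow> h (p + q) = h p \<oplus>\<^bsub>L\<^esub> h q"
  "h 1 = \<one>\<^bsub>L\<^esub>" "h 0 = \<zero>\<^bsub>L\<^esub>"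
  using h.hom_mult[of p q] h.hom_add[of p q] h.hom_one h.hom_zero by auto

text \<open>The polynomial \<open>u\<close> represents the witness in the equality of fractions. Its
  nonzero value at the origin later allows it to be cancelled up to terms of higher order.\<close>

lemma h_eqD:
  assumes "p \<in> carrier P" "q \<in> carrier P" "h p = h q"
  obtains u where "u \<in> carrier P" "\<epsilon> u \<noteq> 0" "\<phi> (u * p) = \<phi> (u * q)"
proof -
  obtain u where u: "u \<in> carrier P" "\<epsilon> u \<noteq> 0" "cls u \<otimes>\<^bsub>R\<^esub> (cls p \<otimes>\<^bsub>R\<^esub> \<one>\<^bsub>R\<^esub>) = cls u \<otimes>\<^bsub>R\<^esub> (cls q \<otimes>\<^bsub>R\<^esub> \<one>\<^bsub>R\<^esub>)"
    using assms Loc.one_T unfolding h_def by (subst (asm) Loc.frac_eq_iff) (auto simp: cls_simps T_eq)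
  then have "cls (u * p) = cls (u * q)" using assms(1,2) by (simp add: cls_simps(1,2))
  then have "\<phi> (u * p) = \<phi> (u * q)" using u(1) assms(1,2) cls_eq_iff by (simp add: poly_ring_closed(2))
  with u that show ?thesis by blast
qed

lemma h_cong: "p \<in> carrier P \<Longrightarrow> q \<in> carrier P \<Longrightarrow> \<phi> p = \<phi> q \<Longrightarrow> h p = h q"
  unfolding h_def using cls_eq_iff[of p q] by simp

lemma h_inverse:
  assumes "q \<in> carrier P" "\<epsilon> q \<noteq> 0"
  obtains y where "y \<in> carrier L" "h q \<otimes>\<^bsub>L\<^esub> y = \<one>\<^bsub>L\<^esub>"
proof (rule that)
  have q: "cls q \<in> T" "cls q \<in> carrier R" using assms cls_in_T cls_simps by auto
  show "frac \<one>\<^bsub>R\<^esub> (cls q) \<in> carrier L" using q by simp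
  show "h q \<otimes>\<^bsub>L\<^esub> frac \<one>\<^bsub>R\<^esub> (cls q) = \<one>\<^bsub>L\<^esub>"
    unfolding h_def Loc.one_L using q Loc.one_T by (simp add: Loc.mult_frac) (rule Loc.frac_eqI; simp)
qed

lemma frac_mult_h:
  assumes "p \<in> carrier P" "q \<in> carrier P" "\<epsilon> q \<noteq> 0"
  shows "frac (cls p) (cls q) \<otimes>\<^bsub>L\<^esub> h q = h p"
proof -
  have q: "cls q \<in> T" "cls q \<in> carrier R" "cls p \<in> carrier R" using assms cls_in_T cls_simps by auto
  show ?thesis
    unfolding h_def using q Loc.one_T by (simp add: Loc.mult_frac) (rule Loc.frac_eqI; simp)
qed

lemma frac_eqI_h:
  assumes "x \<in> carrier L" "p \<in> carrier P" "q \<in> carrier P" "\<epsilon> q \<noteq> 0" "x \<otimes>\<^bsub>L\<^esub> h q = h p"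
  shows "x = frac (cls p) (cls q)"
proof -
  obtain y where y: "y \<in> carrier L" "h q \<otimes>\<^bsub>L\<^esub> y = \<one>\<^bsub>L\<^esub>" using h_inverse assms by metis
  have c: "frac (cls p) (cls q) \<in> carrier L" "h q \<in> carrier L"
    using assms cls_in_T cls_simps by auto
  have "x = (x \<otimes>\<^bsub>L\<^esub> h q) \<otimes>\<^bsub>L\<^esub> y" using y c assms(1) by (simp add: L.m_assoc)
  also have "\<dots> = (frac (cls p) (cls q) \<otimes>\<^bsub>L\<^esub> h q) \<otimes>\<^bsub>L\<^esub> y"
    using assms frac_mult_h by simp
  also have "\<dots> = frac (cls p) (cls q)" using y c by (simp add: L.m_assoc)
  finally show ?thesis .
qed

section \<open>Powers of the maximal ideal of the local ring\<close>

text \<open>\<open>N r\<close> turns out to be the \<open>r\<close>-th power of the maximal ideal.\<close>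

definition N :: "nat \<Rightarrow> ('k mpoly set \<times> 'k mpoly set) set set" where
  "N r = {x \<in> carrier L. \<exists>p q. p \<in> carrier P \<and> q \<in> carrier P \<and> \<phi> p \<in> F r \<and> \<epsilon> q \<noteq> 0 \<and> x \<otimes>\<^bsub>L\<^esub> h q = h p}"

lemma N_I:
  "x \<in> carrier L \<Longrightarrow> p \<in> carrier P \<Longrightarrow> q \<in> carrier P \<Longrightarrow> \<phi> p \<in> F r \<Longrightarrow> \<epsilon> q \<noteq> 0 \<Longrightarrow> x \<otimes>\<^bsub>L\<^esub> h q = h p \<Longrightarrow> x \<in> N r"
  unfolding N_def by blast

lemma N_E:
  assumes "x \<in> N r"
  obtains p q where "x \<in> carrier L" "p \<in> carrier P" "q \<in> carrier P" "\<phi> p \<in> F r" "\<epsilon> q \<noteq> 0" "x \<otimes>\<^bsub>L\<^esub> h q = h p"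
  using assms unfolding N_def by blast

lemma h_in_N: "p \<in> carrier P \<Longrightarrow> \<phi> p \<in> F r \<Longrightarrow> h p \<in> N r"
  by (rule N_I[where q = 1 and p = p]) (auto simp: poly_ring_closed h_simps)

lemma N_0: "N 0 = carrier L"
proof (rule antisym)
  show "carrier L \<subseteq> N 0"
  proof
    fix x assume x: "x \<in> carrier L"
    then obtain a s where as: "x = frac a s" "a \<in> carrier R" "s \<in> T" by (rule Loc.L_cases)
    obtain p where p: "a = cls p" "p \<in> carrier P" using as(2) carrier_R by blast
    obtain q where q: "s = cls q" "q \<in> carrier P" "\<epsilon> q \<noteq> 0" using as(3) by (rule T_cases)
    have pq: "x = frac (cls p) (cls q)" "p \<in> carrier P" "q \<in> carrier P" "\<epsilon> q \<noteq> 0"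
      using as(1) p q by simp_all
    show "x \<in> N 0"
      by (rule N_I[OF x pq(2,3) phi_F0 pq(4)]) (simp only: pq(1) frac_mult_h[OF pq(2-4)])
  qed
qed (auto simp: N_def)

lemma N_1: "N 1 = toric_max_ideal K ms"
proof (rule antisym)
  show "N 1 \<subseteq> toric_max_ideal K ms"
  proof
    fix x assume "x \<in> N 1"
    then obtain p q where pq: "x \<in> carrier L" "p \<in> carrier P" "q \<in> carrier P" "\<phi> p \<in> F 1" "\<epsilon> q \<noteq> 0" "x \<otimes>\<^bsub>L\<^esub> h q = h p"
      by (rule N_E)
    have "cls p \<in> coord_origin_ideal K ms"
      using pq F_1_iff[OF phi_F0] mem_origin_iff by blast
    moreover have "x = frac (cls p) (cls q)" using pq frac_eqI_h by blast
    moreover have "cls q \<in> T" using pq cls_in_T by blast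
    ultimately show "x \<in> toric_max_ideal K ms"
      unfolding toric_max_ideal_def local_max_ideal_def by blast
  qed
  show "toric_max_ideal K ms \<subseteq> N 1"
  proof
    fix x assume "x \<in> toric_max_ideal K ms"
    then obtain a s where as: "x = frac a s" "a \<in> coord_origin_ideal K ms" "s \<in> T"
      unfolding toric_max_ideal_def local_max_ideal_def by blast
    obtain p where p: "a = cls p" "p \<in> carrier P" "\<epsilon> p = 0"
      using as(2) coord_origin_ideal_eq by blast
    obtain q where q: "s = cls q" "q \<in> carrier P" "\<epsilon> q \<noteq> 0"
      using as(3) by (rule T_cases)
    have pq: "x = frac (cls p) (cls q)" "p \<in> carrier P" "q \<in> carrier P" "\<epsilon> q \<noteq> 0" "\<epsilon> p = 0"
      using as(1) p q by simp_all
    have "x \<in> carrier L" using pq cls_in_T cls_simps by simp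
    moreover have "\<phi> p \<in> F 1" using pq F_1_iff[OF phi_F0] by blast
    ultimately show "x \<in> N 1"
      using pq frac_mult_h by (intro N_I[of x p q]) auto
  qed
qed

lemma N_mono: "s \<le> r \<Longrightarrow> N r \<subseteq> N s"
  using F_mono unfolding N_def by blast

lemma N_add:
  assumes "x \<in> N r" "y \<in> N r"
  shows "x \<oplus>\<^bsub>L\<^esub> y \<in> N r"
proof -
  obtain p q where x: "x \<in> carrier L" "p \<in> carrier P" "q \<in> carrier P" "\<phi> p \<in> F r" "\<epsilon> q \<noteq> 0" "x \<otimes>\<^bsub>L\<^esub> h q = h p"
    using assms(1) by (rule N_E)
  obtain p' q' where y: "y \<in> carrier L" "p' \<in> carrier P" "q' \<in> carrier P" "\<phi> p' \<in> F r" "\<epsilon> q' \<noteq> 0" "y \<otimes>\<^bsub>L\<^esub> h q' = h p'"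
    using assms(2) by (rule N_E)
  have c: "h p \<in> carrier L" "h q \<in> carrier L" "h p' \<in> carrier L" "h q' \<in> carrier L"
    using x y by auto
  have "(x \<oplus>\<^bsub>L\<^esub> y) \<otimes>\<^bsub>L\<^esub> h (q * q') = (x \<otimes>\<^bsub>L\<^esub> h q) \<otimes>\<^bsub>L\<^esub> h q' \<oplus>\<^bsub>L\<^esub> (y \<otimes>\<^bsub>L\<^esub> h q') \<otimes>\<^bsub>L\<^esub> h q"
    using x(1,3) y(1,3) c by (simp add: h_simps(1) L.l_distr L.r_distr L.m_ac)
  also have "\<dots> = h (p * q' + p' * q)"
    using x(2-3,6) y(2-3,6) by (simp add: h_simps(1,2) poly_ring_closed(2))
  finally have "(x \<oplus>\<^bsub>L\<^esub> y) \<otimes>\<^bsub>L\<^esub> h (q * q') = h (p * q' + p' * q)" .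
  moreover have "\<phi> (p * q' + p' * q) \<in> F r"
    using F_mult[OF x(4) phi_F0, of q'] F_mult[OF y(4) phi_F0, of q] by (simp add: push_add phi_mult F_add)
  ultimately show ?thesis
    using x(1-5) y(1-5)
    by (intro N_I[of _ "p * q' + p' * q" "q * q'"]) (simp_all add: poly_ring_closed(1,2) \<epsilon>_nonzero)
qed

lemma N_mult:
  assumes "x \<in> N r" "y \<in> N s"
  shows "x \<otimes>\<^bsub>L\<^esub> y \<in> N (r + s)"
proof -
  obtain p q where x: "x \<in> carrier L" "p \<in> carrier P" "q \<in> carrier P" "\<phi> p \<in> F r" "\<epsilon> q \<noteq> 0" "x \<otimes>\<^bsub>L\<^esub> h q = h p"
    using assms(1) by (rule N_E)
  obtain p' q' where y: "y \<in> carrier L" "p' \<in> carrier P" "q' \<in> carrier P" "\<phi> p' \<in> F s" "\<epsilon> q' \<noteq> 0" "y \<otimes>\<^bsub>L\<^esub> h q' = h p'"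
    using assms(2) by (rule N_E)
  have c: "h p \<in> carrier L" "h q \<in> carrier L" "h p' \<in> carrier L" "h q' \<in> carrier L"
    using x y by auto
  have "(x \<otimes>\<^bsub>L\<^esub> y) \<otimes>\<^bsub>L\<^esub> h (q * q') = (x \<otimes>\<^bsub>L\<^esub> h q) \<otimes>\<^bsub>L\<^esub> (y \<otimes>\<^bsub>L\<^esub> h q')"
    using x(1,3) y(1,3) c by (simp add: h_simps(1) L.m_ac)
  also have "\<dots> = h (p * p')"
    using x y by (simp add: h_simps)
  finally have "(x \<otimes>\<^bsub>L\<^esub> y) \<otimes>\<^bsub>L\<^esub> h (q * q') = h (p * p')" .
  then show ?thesis
    using x(1-5) y(1-5) F_mult[OF x(4) y(4)]
    by (intro N_I[of _ "p * p'" "q * q'"]) (simp_all add: poly_ring_closed(2) \<epsilon>_nonzero flip: phi_mult)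
qed

lemma N_ideal: "ideal (N r) L"
proof (rule idealI[OF L.ring_axioms])
  have zero: "\<zero>\<^bsub>L\<^esub> \<in> N r" using h_in_N[of 0] by (simp add: h_simps poly_ring_closed)
  have l: "x \<otimes>\<^bsub>L\<^esub> a \<in> N r" if "a \<in> N r" "x \<in> carrier L" for a x
    using N_mult[of x 0 a r] that N_0 by simp
  have "\<ominus>\<^bsub>L\<^esub> x \<in> N r" if "x \<in> N r" for x
  proof -
    have "x \<in> carrier L" using that by (auto simp: N_def)
    then show ?thesis using l[OF that, of "\<ominus>\<^bsub>L\<^esub> \<one>\<^bsub>L\<^esub>"] by (simp add: L.l_minus)
  qed
  then show "subgroup (N r) (add_monoid L)"
    using zero N_add by (intro L.add.subgroupI) (auto simp: N_def simp flip: a_inv_def)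
  show "x \<otimes>\<^bsub>L\<^esub> a \<in> N r" if "a \<in> N r" "x \<in> carrier L" for a x using l that .
  show "a \<otimes>\<^bsub>L\<^esub> x \<in> N r" if "a \<in> N r" "x \<in> carrier L" for a x
    using N_mult[of a r x 0] that N_0 by simp
qed

text \<open>Because \<open>rep\<close> is a section of \<open>deg_S\<close>, pushing along it gives
  a right inverse of \<open>phi\<close> on the semigroup algebra.\<close>

lemma push_rep_closed:
  assumes "f \<in> F 0"
  shows "push rep f \<in> carrier P" "phi ms (push rep f) = f"
proof -
  have *: "x \<in> S" if "x \<in> Poly_Mapping.keys f" for x using assms that by (auto simp: F_def)
  show "push rep f \<in> carrier P"
    unfolding push_def using rep(1) * by (intro poly_ring_sum_closed poly_ring_closed) auto
  have "phi ms (push rep f) = push (\<lambda>x. x) f"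
    unfolding push_push using rep(2) * by (intro push_cong) auto
  then show "phi ms (push rep f) = f" by (simp add: push_id)
qed

lemma h_sum_in_ideal:
  assumes "ideal J L" "\<And>i. i \<in> A \<Longrightarrow> f i \<in> carrier P \<and> h (f i) \<in> J"
  shows "h (\<Sum>i\<in>A. f i) \<in> J"
proof -
  interpret J: additive_subgroup J L using assms(1) by (rule ideal.axioms)
  show ?thesis using assms(2)
    by (induction A rule: infinite_finite_induct)
      (auto simp: h_simps J.zero_closed poly_ring_sum_closed)
qed

text \<open>One inclusion is the multiplicativity of the filtration. For the other, the
  representative of an element of order at least \<open>Suc r\<close> has total degree at least
  \<open>Suc r\<close>, so one variable can be split off: the variable lies in \<open>N 1\<close>,
  and the cofactor, of degree at least \<open>r\<close>, lies in \<open>N r\<close>.\<close>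

lemma ideal_prod_N: "N r \<cdot>\<^bsub>L\<^esub> N 1 = N (Suc r)"
proof (rule antisym)
  show "N r \<cdot>\<^bsub>L\<^esub> N 1 \<subseteq> N (Suc r)"
  proof
    fix x assume "x \<in> N r \<cdot>\<^bsub>L\<^esub> N 1"
    then show "x \<in> N (Suc r)"
      by induction (use N_mult[of _ r _ 1] N_add in auto)
  qed
  let ?J = "N r \<cdot>\<^bsub>L\<^esub> N 1"
  have J: "ideal ?J L" by (intro L.ideal_prod_is_ideal N_ideal)
  have mon: "h (Poly_Mapping.single (rep x) c) \<in> ?J" if x: "x \<in> S" "Suc r \<le> ord x" for x c
  proof -
    have "0 < weight (rep x)" using rep(3)[OF x(1)] x(2) by simp
    with rep(1)[OF x(1)] obtain u i where u: "u \<in> monomials n" "i < n"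
      "rep x = u + Poly_Mapping.single i 1" "weight (rep x) = weight u + 1"
      by (rule monomial_split)
    have i: "Poly_Mapping.single i 1 \<in> monomials n" using u by (auto simp: monomials_def)
    have "weight (Poly_Mapping.single i 1) = 1" using u(2) by (simp add: lookup_single when_def)
    then have "1 \<le> ord (deg_S ms (Poly_Mapping.single i 1))"
      using weight_le_ord_deg[of "Poly_Mapping.single i 1"] by simp
    then have "h (Poly_Mapping.single (Poly_Mapping.single i 1) 1) \<in> N 1"
      by (intro h_in_N poly_ring_closed i) (simp only: push_single, intro F_single, auto)
    moreover have "r \<le> ord (deg_S ms u)"
      using weight_le_ord_deg[of u] u(4) rep(3)[OF x(1)] x(2) by simp
    then have "h (Poly_Mapping.single u c) \<in> N r"
      by (intro h_in_N poly_ring_closed u) (simp only: push_single, intro F_single, auto)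
    moreover have "h (Poly_Mapping.single (rep x) c) =
        h (Poly_Mapping.single u c) \<otimes>\<^bsub>L\<^esub> h (Poly_Mapping.single (Poly_Mapping.single i 1) 1)"
      using u i by (simp add: h_simps(1)[symmetric] poly_ring_closed mult_single)
    ultimately show ?thesis by (simp only: ideal_prod.prod)
  qed
  show "N (Suc r) \<subseteq> ?J"
  proof
    fix x assume "x \<in> N (Suc r)"
    then obtain p q where x: "x \<in> carrier L" "p \<in> carrier P" "q \<in> carrier P" "\<phi> p \<in> F (Suc r)" "\<epsilon> q \<noteq> 0" "x \<otimes>\<^bsub>L\<^esub> h q = h p"
      by (rule N_E)
    obtain y where y: "y \<in> carrier L" "h q \<otimes>\<^bsub>L\<^esub> y = \<one>\<^bsub>L\<^esub>" using h_inverse x by metis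
    have keys: "y \<in> S \<and> Suc r \<le> ord y" if "y \<in> Poly_Mapping.keys (\<phi> p)" for y
      using x(4) that by (auto simp: F_def)
    \<comment> \<open>The polynomial \<open>p\<close> itself may contain monomials of low degree.
      Its normal form has the same image under \<open>h\<close> and contains only monomials of
      degree at least \<open>Suc r\<close>.\<close>
    have "h (push rep (\<phi> p)) \<in> ?J"
      unfolding push_def[of rep] using keys mon rep(1)
      by (intro h_sum_in_ideal[OF J]) (auto intro!: poly_ring_closed)
    moreover have "h (push rep (\<phi> p)) = h p"
      using x push_rep_closed[OF phi_F0] by (intro h_cong) auto
    ultimately have "h p \<otimes>\<^bsub>L\<^esub> y \<in> ?J" using ideal.I_r_closed[OF J _ y(1)] by simp
    moreover have "h p \<otimes>\<^bsub>L\<^esub> y = x"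
      using x y by (simp flip: x(6) add: L.m_assoc)
    ultimately show "x \<in> ?J" by simp
  qed
qed

lemma max_ideal_pow: "toric_max_ideal K ms [^]\<^bsub>ideals_set L\<^esub> (r::nat) = N r"
proof (induction r)
  case 0
  then show ?case by (simp add: nat_pow_def ideals_set_def N_0)
next
  case (Suc r)
  have "toric_max_ideal K ms [^]\<^bsub>ideals_set L\<^esub> Suc r
      = (toric_max_ideal K ms [^]\<^bsub>ideals_set L\<^esub> r) \<cdot>\<^bsub>L\<^esub> toric_max_ideal K ms"
    by (simp add: nat_pow_def ideals_set_def)
  also have "\<dots> = N (Suc r)" using ideal_prod_N[of r] by (simp only: Suc.IH N_1)
  finally show ?case .
qed

text \<open>Clearing denominators shows that the product of \<open>\<phi> p\<close> with
  \<open>\<phi> (u * q)\<close> has order at least \<open>Suc r\<close>. Modulo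
  \<open>F (Suc r)\<close> that multiplier acts on \<open>F r\<close> as its nonzero constant term,
  which can be divided out. Thus localization creates no new elements of higher order, which gives
  the linear independence below.\<close>

lemma h_in_N_SucD:
  assumes "p \<in> carrier P" "\<phi> p \<in> F r" "h p \<in> N (Suc r)"
  shows "\<phi> p \<in> F (Suc r)"
proof -
  obtain p' q where q: "p' \<in> carrier P" "q \<in> carrier P" "\<phi> p' \<in> F (Suc r)" "\<epsilon> q \<noteq> 0" "h p \<otimes>\<^bsub>L\<^esub> h q = h p'"
    using assms(3) by (rule N_E)
  then have "h (p * q) = h p'" using assms by (simp add: h_simps)
  then obtain u where u: "u \<in> carrier P" "\<epsilon> u \<noteq> 0" "\<phi> (u * (p * q)) = \<phi> (u * p')"
    using h_eqD assms q by (metis poly_ring_closed(2))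
  let ?c = "\<epsilon> (u * q)"
  have "\<phi> (u * q) * \<phi> p \<in> F (Suc r)"
    using F_mult[OF phi_F0 q(3), of u] u(3) by (simp add: phi_mult mult_ac)
  moreover have "\<phi> (u * q) * \<phi> p - Poly_Mapping.single 0 ?c * \<phi> p \<in> F (Suc r)"
    by (rule F_mult_constant[OF phi_F0 assms(2)])
  ultimately have "Poly_Mapping.single 0 ?c * \<phi> p \<in> F (Suc r)"
    using F_diff by fastforce
  moreover have "?c \<noteq> 0" using u q by (simp add: \<epsilon>_mult)
  ultimately show ?thesis
    by (auto simp: F_def subset_eq in_keys_iff lookup_const_mult)
qed

section \<open>A basis of the graded pieces\<close>

definition constants :: "'k mpoly set" where
  "constants = range (Poly_Mapping.single 0)"

lemma constants_subfield: "subfield constants P"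
proof (rule P.subfieldI)
  show "subcring constants P"
  proof (intro P.subcringI P.subringI)
    show "constants \<subseteq> carrier P" by (auto simp: constants_def poly_ring_closed)
  qed (auto simp: constants_def a_inv_poly_ring poly_ring_closed mult_single
      simp flip: single_one single_uminus single_add)
  have "\<exists>d. Poly_Mapping.single 0 (d * c) = (1 :: 'k mpoly)" if "c \<noteq> 0" for c :: 'k
    using that by (intro exI[of _ "inverse c"]) simp
  moreover have "Poly_Mapping.single 0 c = (0 :: 'k mpoly) \<longleftrightarrow> c = 0" for c
    by (metis lookup_single_eq lookup_zero single_zero)
  ultimately show "Units (P\<lparr>carrier := constants\<rparr>) = constants - {\<zero>\<^bsub>P\<^esub>}"
    by (auto simp: Units_def constants_def mult_single mult.commute)
qed

text \<open>Linear combinations in a ring take lists of coefficients; this turns such a list into a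
  function on the basis elements, well defined since each element has only one position.\<close>

lemma list_eq_map_if_distinct:
  assumes "distinct xs" "length ks = length xs"
  shows "\<exists>c. ks = map c xs"
proof (intro exI nth_equalityI)
  let ?c = "\<lambda>x. ks ! (THE i. i < length xs \<and> xs ! i = x)"
  show "length ks = length (map ?c xs)" using assms by simp
  fix i assume i: "i < length ks"
  then have "(THE j. j < length xs \<and> xs ! j = xs ! i) = i"
    using assms by (auto simp: nth_eq_iff_index_eq)
  then show "ks ! i = map ?c xs ! i" using i assms(2) by simp
qed

abbreviation rep_monom :: "nat ^ 'd \<Rightarrow> 'k mpoly" where
  "rep_monom x \<equiv> Poly_Mapping.single (rep x) 1"

lemma combine_constants_rep_monom:
  "distinct xs \<Longrightarrow> P.combine (map (\<lambda>x. Poly_Mapping.single 0 (c x)) xs) (map rep_monom xs) =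
    (\<Sum>x\<in>set xs. Poly_Mapping.single (rep x) (c x))"
  by (induction xs) (simp_all add: mult_single)

text \<open>The classes of the monomials \<open>rep x\<close> with \<open>x\<close> in the level are
  linearly independent because passing to the local ring does not raise orders. They span because a
  denominator acts on the graded piece as its value at the origin, so that the leading part of a
  fraction is a scalar multiple of that of its numerator.\<close>

theorem toric_hilbert_fun_eq_card: "toric_hilbert_fun K ms r = card (level ms r)"
proof -
  let ?M = "N (Suc r)"
  let ?Q = "L Quot ?M"
  interpret M: ideal ?M L by (rule N_ideal)
  interpret Q: ring ?Q by (rule M.quotient_is_ring)
  interpret \<pi>: ring_hom_ring L ?Q "(+>\<^bsub>L\<^esub>) ?M" by (rule M.rcos_ring_hom_ring)
  \<comment> \<open>Mapping \<open>P\<close> directly to the quotient allows linear combinations to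
    be formed among polynomials and transported.\<close>
  define g where "g p = ?M +>\<^bsub>L\<^esub> h p" for p
  have "g \<in> ring_hom P ?Q"
    using ring_hom_trans[OF h.homh \<pi>.homh] by (simp add: g_def[abs_def] comp_def)
  then interpret g: ring_hom_ring P ?Q g
    by (rule ring_hom_ringI2[OF P.ring_axioms Q.ring_axioms])
  have zero_iff: "?M +>\<^bsub>L\<^esub> x = \<zero>\<^bsub>?Q\<^esub> \<longleftrightarrow> x \<in> ?M" if "x \<in> carrier L" for x
  proof
    show "x \<in> ?M" if "?M +>\<^bsub>L\<^esub> x = \<zero>\<^bsub>?Q\<^esub>"
      using M.a_rcos_self[OF \<open>x \<in> carrier L\<close>] that unfolding FactRing_zero by blast
    show "?M +>\<^bsub>L\<^esub> x = \<zero>\<^bsub>?Q\<^esub>" if "x \<in> ?M"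
      unfolding FactRing_zero by (rule M.a_rcos_const[OF that])
  qed
  have constants: "(+>\<^bsub>L\<^esub>) ?M ` toric_constants K ms = g ` constants"
    unfolding toric_constants_def constants_def g_def h_def by auto
  \<comment> \<open>The image of the field of constants is a subfield once the quotient is
    nontrivial, and it is nontrivial because 1 has order zero.\<close>
  have "\<one>\<^bsub>?Q\<^esub> \<noteq> \<zero>\<^bsub>?Q\<^esub>"
  proof
    assume "\<one>\<^bsub>?Q\<^esub> = \<zero>\<^bsub>?Q\<^esub>"
    then have "h 1 \<in> ?M"
      using zero_iff[of "\<one>\<^bsub>L\<^esub>"] \<pi>.hom_one by (simp add: h_simps(3))
    then have "h 1 \<in> N 1" using N_mono[of 1 "Suc r"] by auto
    then have "\<phi> 1 \<in> F 1"
      using h_in_N_SucD[OF poly_ring_closed(6) phi_F0] by simp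
    then show False using F_1_iff[OF phi_F0, of "1 :: 'k mpoly"] by simp
  qed
  then have sub: "subfield (g ` constants) ?Q"
    using g.img_is_subfield(2)[OF constants_subfield] by blast
  obtain xs where xs: "set xs = level ms r" "distinct xs"
    using finite_distinct_list[OF finite_level] by blast
  have lev: "x \<in> S" "ord x = r" "rep x \<in> monomials n" if "x \<in> set xs" for x
    using that rep(1) by (auto simp: xs level_def)
  define comb where "comb c = (\<Sum>x\<in>set xs. Poly_Mapping.single (rep x) (c x))" for c :: "nat ^ 'd \<Rightarrow> 'k"
  have comb_carrier: "comb c \<in> carrier P" for c
    unfolding comb_def using lev by (intro poly_ring_sum_closed poly_ring_closed) auto
  have phi_comb: "\<phi> (comb c) = (\<Sum>x\<in>set xs. Poly_Mapping.single x (c x))" for c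
    unfolding comb_def push_sum using lev rep(2) by (intro sum.cong) auto
  have lookup_comb: "Poly_Mapping.lookup (\<phi> (comb c)) x = (c x when x \<in> set xs)" for c x
    by (simp add: phi_comb lookup_sum lookup_single when_def)
  have comb_F: "\<phi> (comb c) \<in> F r" for c
    unfolding phi_comb using lev by (intro F_sum F_single) auto
  let ?Us = "map g (map rep_monom xs)"
  have rep_monom_carrier: "set (map rep_monom xs) \<subseteq> carrier P"
    using lev by (auto intro: poly_ring_closed)
  have Us: "set ?Us \<subseteq> carrier ?Q" using rep_monom_carrier g.hom_closed by auto
  have combine: "Q.combine (map (\<lambda>x. g (Poly_Mapping.single 0 (c x))) xs) ?Us = g (comb c)" for c
  proof -
    have "Q.combine (map g (map (\<lambda>x. Poly_Mapping.single 0 (c x)) xs)) ?Us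
        = g (P.combine (map (\<lambda>x. Poly_Mapping.single 0 (c x)) xs) (map rep_monom xs))"
      using rep_monom_carrier by (intro g.combine_hom) (auto simp: poly_ring_closed)
    then show ?thesis unfolding combine_constants_rep_monom[OF xs(2)] comb_def by (simp add: comp_def)
  qed
  have coeffs: "\<exists>c. Ks = map (\<lambda>x. g (Poly_Mapping.single 0 (c x))) xs"
    if Ks: "set Ks \<subseteq> g ` constants" "length Ks = length ?Us" for Ks
  proof -
    obtain k where k: "Ks = map k xs"
      using list_eq_map_if_distinct[OF xs(2), of Ks] Ks(2) by auto
    then have "\<forall>x\<in>set xs. \<exists>d. k x = g (Poly_Mapping.single 0 d)"
      using Ks(1) by (auto simp: constants_def)
    then obtain c where "\<forall>x\<in>set xs. k x = g (Poly_Mapping.single 0 (c x))" by metis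
    then show ?thesis using k by auto
  qed
  have indep: "Q.independent (g ` constants) ?Us"
  proof (rule Q.trivial_combine_imp_independent[OF sub Us])
    fix Ks assume Ks: "set Ks \<subseteq> g ` constants" "Q.combine Ks ?Us = \<zero>\<^bsub>?Q\<^esub>"
    have sc: "g ` constants \<subseteq> carrier ?Q" using sub by (rule subfieldE)
    \<comment> \<open>A coefficient list in \<open>combine\<close> may be shorter or longer than the
      list of vectors; it is first brought to the same length, padding with zeros, so that
      \<open>coeffs\<close> applies.\<close>
    obtain Ks' where Ks': "set (take (length ?Us) Ks) \<subseteq> set Ks'" "set Ks' \<subseteq> set (take (length ?Us) Ks) \<union> {\<zero>\<^bsub>?Q\<^esub>}"
      "length Ks' = length ?Us" "Q.combine Ks' ?Us = \<zero>\<^bsub>?Q\<^esub>"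
      using Q.combine_normalize[OF order_trans[OF Ks(1) sc] Us Ks(2)] .
    have "\<zero>\<^bsub>?Q\<^esub> \<in> g ` constants" using subringE(2)[OF subfieldE(1)[OF sub]] .
    then have "set Ks' \<subseteq> g ` constants" using Ks'(2) Ks(1) set_take_subset[of "length ?Us" Ks] by blast
    then obtain c where c: "Ks' = map (\<lambda>x. g (Poly_Mapping.single 0 (c x))) xs"
      using coeffs Ks'(3) by blast
    have "g (comb c) = \<zero>\<^bsub>?Q\<^esub>" using Ks'(4) unfolding c combine .
    then have "h (comb c) \<in> ?M" using zero_iff[of "h (comb c)"] comb_carrier by (simp add: g_def)
    \<comment> \<open>All elements occurring in \<open>\<phi> (comb c)\<close> have order exactly
      \<open>r\<close>, so order at least \<open>Suc r\<close> forces every coefficient to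
      vanish.\<close>
    then have "\<phi> (comb c) \<in> F (Suc r)"
      using h_in_N_SucD comb_carrier comb_F by blast
    then have keys: "Suc r \<le> ord x" if "x \<in> Poly_Mapping.keys (\<phi> (comb c))" for x
      using that by (auto simp: F_def)
    have "c x = 0" if x: "x \<in> set xs" for x
    proof (rule ccontr)
      assume "c x \<noteq> 0"
      then have "x \<in> Poly_Mapping.keys (\<phi> (comb c))"
        using x lookup_comb[of c x] by (simp add: in_keys_iff)
      then show False using keys[of x] lev(2)[OF x] by simp
    qed
    then have "set Ks' \<subseteq> {\<zero>\<^bsub>?Q\<^esub>}"
      using g.hom_zero by (auto simp: c)
    then show "set (take (length ?Us) Ks) \<subseteq> {\<zero>\<^bsub>?Q\<^esub>}" using Ks'(1) by blast
  qed
  have "Q.Span (g ` constants) ?Us = graded_piece L (toric_max_ideal K ms) r"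
    unfolding graded_piece_def max_ideal_pow
  proof (intro equalityI subsetI)
    fix y assume "y \<in> Q.Span (g ` constants) ?Us"
    then obtain Ks where "set Ks \<subseteq> g ` constants" "length Ks = length ?Us" "y = Q.combine Ks ?Us"
      using Q.Span_mem_iff_length_version[OF sub Us] by blast
    then obtain c where "y = g (comb c)" using coeffs combine by metis
    then show "y \<in> (+>\<^bsub>L\<^esub>) ?M ` N r"
      using h_in_N[OF comb_carrier comb_F] by (auto simp: g_def)
  next
    fix y assume "y \<in> (+>\<^bsub>L\<^esub>) ?M ` N r"
    then obtain x where x: "x \<in> N r" "y = ?M +>\<^bsub>L\<^esub> x" by blast
    then obtain p q where pq: "x \<in> carrier L" "p \<in> carrier P" "q \<in> carrier P" "\<phi> p \<in> F r" "\<epsilon> q \<noteq> 0" "x \<otimes>\<^bsub>L\<^esub> h q = h p"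
      by (elim N_E)
    \<comment> \<open>Here \<open>x\<close> is the fraction with numerator \<open>p\<close> and
      denominator \<open>q\<close>. As \<open>q\<close> acts in top order like the scalar
      \<open>\<epsilon> q\<close>, the leading coefficients of \<open>x\<close> are those of
      \<open>\<phi> p\<close> divided by \<open>\<epsilon> q\<close>.\<close>
    define c where "c x = Poly_Mapping.lookup (\<phi> p) x / \<epsilon> q" for x
    have hc: "h (comb c) \<in> carrier L" "h q \<in> carrier L" "h (comb c * q) \<in> carrier L"
      using comb_carrier pq by (auto simp: poly_ring_closed)
    have "h p = h ((p - comb c * q) + comb c * q)" by simp
    also have "\<dots> = h (p - comb c * q) \<oplus>\<^bsub>L\<^esub> h (comb c * q)"
      using pq comb_carrier by (intro h_simps) (auto simp: poly_ring_closed)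
    finally have hp: "h p = h (p - comb c * q) \<oplus>\<^bsub>L\<^esub> h (comb c) \<otimes>\<^bsub>L\<^esub> h q"
      using pq comb_carrier by (simp add: h_simps)
    have hd: "h (p - comb c * q) \<in> carrier L" using pq comb_carrier by (auto simp: poly_ring_closed)
    have "(x \<ominus>\<^bsub>L\<^esub> h (comb c)) \<otimes>\<^bsub>L\<^esub> h q = h p \<ominus>\<^bsub>L\<^esub> h (comb c) \<otimes>\<^bsub>L\<^esub> h q"
      using pq hc by (simp add: L.l_distr L.l_minus a_minus_def)
    also have "\<dots> = h (p - comb c * q)"
      unfolding hp using hc hd by (simp add: a_minus_def L.a_assoc L.r_neg)
    finally have eq: "(x \<ominus>\<^bsub>L\<^esub> h (comb c)) \<otimes>\<^bsub>L\<^esub> h q = h (p - comb c * q)" .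
    \<comment> \<open>The image of the numerator of \<open>x\<close> minus
      \<open>h (comb c)\<close>, with \<open>q\<close> replaced by its value at the origin. By the
      choice of \<open>c\<close> all its coefficients at elements of order \<open>r\<close>
      cancel.\<close>
    let ?f = "\<phi> p - Poly_Mapping.single 0 (\<epsilon> q) * \<phi> (comb c)"
    have "Poly_Mapping.lookup ?f x = 0" if "x \<in> set xs" for x
      using that pq(5) by (simp add: lookup_minus lookup_const_mult lookup_comb c_def)
    moreover have "?f \<in> F r"
      using F_mult[OF F_single[of 0 0] comb_F] pq(4) by (intro F_diff) auto
    ultimately have "?f \<in> F (Suc r)"
      unfolding F_def xs level_def in_keys_iff
      by (auto simp: in_keys_iff subset_eq Suc_le_eq order_less_le)
    \<comment> \<open>Putting \<open>q\<close> back in place of its value changes the numerator only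
      in orders at least \<open>Suc r\<close>.\<close>
    moreover have "\<phi> q * \<phi> (comb c) - Poly_Mapping.single 0 (\<epsilon> q) * \<phi> (comb c) \<in> F (Suc r)"
      by (rule F_mult_constant[OF phi_F0 comb_F])
    ultimately have "?f - (\<phi> q * \<phi> (comb c) - Poly_Mapping.single 0 (\<epsilon> q) * \<phi> (comb c)) \<in> F (Suc r)"
      by (rule F_diff)
    then have "\<phi> (p - comb c * q) \<in> F (Suc r)"
      by (simp add: push_diff phi_mult mult.commute)
    then have "x \<ominus>\<^bsub>L\<^esub> h (comb c) \<in> ?M"
      using pq hc comb_carrier eq by (intro N_I[of _ "p - comb c * q" q]) (auto simp: poly_ring_closed)
    then have "y = g (comb c)"
      using L.quotient_eq_iff_same_a_r_cos[OF N_ideal pq(1) hc(1)] x(2) by (simp add: g_def)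
    moreover have "set (map (\<lambda>x. g (Poly_Mapping.single 0 (c x))) xs) \<subseteq> g ` constants"
      by (auto simp: constants_def)
    ultimately show "y \<in> Q.Span (g ` constants) ?Us"
      unfolding Q.Span_mem_iff_length_version[OF sub Us] combine[symmetric]
      by (intro exI[of _ "map (\<lambda>x. g (Poly_Mapping.single 0 (c x))) xs"]) auto
  qed
  then have "Q.dimension (length ?Us) (g ` constants) (graded_piece L (toric_max_ideal K ms) r)"
    using Q.dimensionI[OF sub indep] by blast
  then have "Q.dim (g ` constants) (graded_piece L (toric_max_ideal K ms) r) = length ?Us"
    using Q.dimI[OF sub] by (simp add: over_def)
  then show ?thesis
    unfolding toric_hilbert_fun_def hilbert_fun_def max_ideal_pow constants
    using distinct_card[OF xs(2)] by (simp add: xs(1))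
qed

end

section \<open>Monotonicity of the Hilbert function of an extension\<close>

theorem theorem3p5:
  fixes ms :: "(nat ^ 'd) list" and m :: "nat ^ 'd" and l :: nat
  assumes "0 \<notin> set ms"
    and "is_extension ms l m"
    and "l \<le> Delta ms m"
    and "\<forall>r. toric_hilbert_fun TYPE('k::alg_closed_field) ms r
               \<le> toric_hilbert_fun TYPE('k) ms (Suc r)"
  shows "\<forall>r. toric_hilbert_fun TYPE('k) (ext_gens ms l m) r
               \<le> toric_hilbert_fun TYPE('k) (ext_gens ms l m) (Suc r)"
proof -
  interpret toric_extension ms l m
    using assms(1-3) by unfold_locales
  interpret base: toric ms "TYPE('k)" by unfold_locales
  interpret ext: toric ms' "TYPE('k)"
    using nonzero_gens_ext by (rule toric.intro)
  show ?thesis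
    using assms(4) card_level_ext_mono
    unfolding base.toric_hilbert_fun_eq_card ext.toric_hilbert_fun_eq_card by blast
qed

end
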